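(* Suppose $f\in C_{\mathbb R}(X)$. Then the values $\overline a(f),\underline a(f),\overline c(f),\underline c(f),\overline d(f),\underline d(f)$ are all well-defined real numbers (in particular the limits defining $\overline d(f)$ and $\underline d(f)$ exist), and $$\overline b(f)\le\overline c(f)=\overline a(f)=\overline d(f),\qquad \underline b(f)\ge\underline c(f)=\underline a(f)=\underline d(f).$$ Furthermore, if for every ergodic measure $\theta\in\partial_e\mathcal M_T(X)$ there exists an $(f,\mathbf F,\theta)$-typical point, then $$\overline a(f)=\overline b(f)=\overline c(f)=\overline d(f),\qquad\underline a(f)=\underline b(f)=\underline c(f)=\underline d(f).$$
   Context: $X$ is a compact metrizable space, $C_{\mathbb R}(X)$ is the space of real-valued continuous functions on $X$, $G$ is a discrete amenable group, and $T:G\curvearrowright X$ is a left action by homeomorphisms $(T_g)_{g\in G}$ ($T_{g_1}\circ T_{g_2}=T_{g_1g_2}$, $T_{1_G}=\mathrm{id}_X$). $\mathbf F=(F_k)_{k=1}^\infty$ is a Følner sequence for $G$, i.e. a sequence of nonempty finite subsets with $\lim_{k\to\infty}|F_k\Delta gF_k|/|F_k|=0$ for all $g\in G$. $\operatorname{Avg}_Ff:=\frac1{|F|}\sum_{g\in F}f\circ T_g$. $\mathcal M_T(X)$ is the set of $T$-invariant Borel probability measures on $X$ with the weak* topology, and $\partial_e\mathcal M_T(X)$ is its set of extreme points (the ergodic measures). $\operatorname{Reg}(f)=\{x\in X:\lim_{k\to\infty}\operatorname{Avg}_{F_k}f(x)\text{ exists}\}$, and $\overline a(f)=\sup\{\int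 f\,\mathrm d\nu:\nu\in\mathcal M_T(X)\}$, $\underline a(f)=\inf\{\int f\,\mathrm d\nu:\nu\in\mathcal M_T(X)\}$; $\overline b(f)=\sup\{\lim_{k\to\infty}\operatorname{Avg}_{F_k}f(x):x\in\operatorname{Reg}(f)\}$, $\underline b(f)=\inf\{\lim_{k\to\infty}\operatorname{Avg}_{F_k}f(x):x\in\operatorname{Reg}(f)\}$, with $\overline b(f)=-\infty$, $\underline b(f)=+\infty$ if $\operatorname{Reg}(f)=\emptyset$; $\overline c(f)=\sup\{\limsup_{k\to\infty}\operatorname{Avg}_{F_k}f(x):x\in X\}$, $\underline c(f)=\inf\{\liminf_{k\to\infty}\operatorname{Avg}_{F_k}f(x):x\in X\}$; $\overline d(f)=\lim_{k\to\infty}\left(\sup\{\operatorname{Avg}_{F_k}f(x):x\in X\}\right)$, $\underline d(f)=\lim_{k\to\infty}\left(\inf\{\operatorname{Avg}_{F_k}f(x):x\in X\}\right)$. For $\nu\in\mathcal M_T(X)$, a point $x\in X$ is $(f,\mathbf F,\nu)$-typical if $\lim_{k\to\infty}\operatorname{Avg}_{F_k}f(x)=\int f\,\mathrm d\nu$. *)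

theory Defs
  imports "HOL-Probability.Probability" "HOL-Algebra.Coset"
begin

text \<open>The group is an explicit-carrier group of HOL-Algebra; the space is a (hence nonempty) type
  of class \<^class>\<open>t2_space\<close>, metrizability and compactness being hypotheses of the theorem.\<close>

section \<open>Amenable groups and Foelner sequences\<close>

text \<open>A left-invariant finitely additive probability measure on all subsets of the group.\<close>

definition amenable_group :: "('g, 'm) monoid_scheme \<Rightarrow> bool" where
  "amenable_group G \<longleftrightarrow> group G \<and>
     (\<exists>m :: 'g set \<Rightarrow> real.
        m (carrier G) = 1 \<and>
        (\<forall>A \<subseteq> carrier G. 0 \<le> m A) \<and>
        (\<forall>A \<subseteq> carrier G. \<forall>B \<subseteq> carrier G. A \<inter> B = {} \<longrightarrow> m (A \<union> B) = m A + m B) \<and>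
        (\<forall>g \<in> carrier G. \<forall>A \<subseteq> carrier G. m (g <#\<^bsub>G\<^esub> A) = m A))"

text \<open>Sequences are indexed from \<open>0\<close> instead of \<open>1\<close>; all notions below only involve limits in the
  index, so this is a mere relabelling.\<close>

definition folner_sequence :: "('g, 'm) monoid_scheme \<Rightarrow> (nat \<Rightarrow> 'g set) \<Rightarrow> bool" where
  "folner_sequence G F \<longleftrightarrow>
     (\<forall>k. finite (F k) \<and> F k \<noteq> {} \<and> F k \<subseteq> carrier G) \<and>
     (\<forall>g \<in> carrier G.
        (\<lambda>k. real (card (sym_diff (F k) (g <#\<^bsub>G\<^esub> F k))) / real (card (F k))) \<longlonglongrightarrow> 0)"

section \<open>Actions, invariant measures, ergodic averages\<close>

definition action_by_homeos ::
    "('g, 'm) monoid_scheme \<Rightarrow> ('g \<Rightarrow> 'x::topological_space \<Rightarrow> 'x) \<Rightarrow> bool" where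
  "action_by_homeos G T \<longleftrightarrow>
     (\<forall>g \<in> carrier G. homeomorphic_map euclidean euclidean (T g)) \<and>
     T \<one>\<^bsub>G\<^esub> = id \<and>
     (\<forall>g \<in> carrier G. \<forall>h \<in> carrier G. T g \<circ> T h = T (g \<otimes>\<^bsub>G\<^esub> h))"

definition invariant_measures ::
    "('g, 'm) monoid_scheme \<Rightarrow> ('g \<Rightarrow> 'x::topological_space \<Rightarrow> 'x) \<Rightarrow> 'x measure set" where
  "invariant_measures G T =
     {\<mu>. prob_space \<mu> \<and> sets \<mu> = sets borel \<and> (\<forall>g \<in> carrier G. distr \<mu> borel (T g) = \<mu>)}"

text \<open>Extreme points of the set of invariant measures. The type of measures is not a real vector
  space, so the library notion \<open>extreme_point_of\<close> does not apply and the convex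
  combination is written out on Borel sets.\<close>

definition ergodic_measures ::
    "('g, 'm) monoid_scheme \<Rightarrow> ('g \<Rightarrow> 'x::topological_space \<Rightarrow> 'x) \<Rightarrow> 'x measure set" where
  "ergodic_measures G T =
     {\<theta> \<in> invariant_measures G T.
        \<forall>\<mu> \<in> invariant_measures G T. \<forall>\<nu> \<in> invariant_measures G T. \<forall>t::real.
          0 < t \<and> t < 1 \<and>
          (\<forall>A \<in> sets borel. measure \<theta> A = (1 - t) * measure \<mu> A + t * measure \<nu> A) \<longrightarrow>
          \<mu> = \<nu>}"

definition Avg :: "('g \<Rightarrow> 'x \<Rightarrow> 'x) \<Rightarrow> 'g set \<Rightarrow> ('x \<Rightarrow> real) \<Rightarrow> 'x \<Rightarrow> real" where
  "Avg T F f x = (\<Sum>g\<in>F. f (T g x)) / real (card F)"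

definition Reg :: "('g \<Rightarrow> 'x \<Rightarrow> 'x) \<Rightarrow> (nat \<Rightarrow> 'g set) \<Rightarrow> ('x \<Rightarrow> real) \<Rightarrow> 'x set" where
  "Reg T F f = {x. convergent (\<lambda>k. Avg T (F k) f x)}"

definition typical_point ::
    "('g \<Rightarrow> 'x \<Rightarrow> 'x) \<Rightarrow> (nat \<Rightarrow> 'g set) \<Rightarrow> ('x \<Rightarrow> real) \<Rightarrow> 'x measure \<Rightarrow> 'x \<Rightarrow> bool" where
  "typical_point T F f \<nu> x \<longleftrightarrow> (\<lambda>k. Avg T (F k) f x) \<longlonglongrightarrow> (\<integral>y. f y \<partial>\<nu>)"

section \<open>The extremal values\<close>

text \<open>All values live in \<^typ>\<open>ereal\<close>, where suprema and infima have their true meaning; in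
  particular those over the empty set are \<open>-\<infinity>\<close> and \<open>\<infinity>\<close>, as needed for \<open>b_upper\<close> and \<open>b_lower\<close>.\<close>

definition a_upper ::
    "('g, 'm) monoid_scheme \<Rightarrow> ('g \<Rightarrow> 'x::topological_space \<Rightarrow> 'x) \<Rightarrow> ('x \<Rightarrow> real) \<Rightarrow> ereal" where
  "a_upper G T f = (SUP \<nu> \<in> invariant_measures G T. ereal (\<integral>y. f y \<partial>\<nu>))"

definition a_lower ::
    "('g, 'm) monoid_scheme \<Rightarrow> ('g \<Rightarrow> 'x::topological_space \<Rightarrow> 'x) \<Rightarrow> ('x \<Rightarrow> real) \<Rightarrow> ereal" where
  "a_lower G T f = (INF \<nu> \<in> invariant_measures G T. ereal (\<integral>y. f y \<partial>\<nu>))"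

definition b_upper :: "('g \<Rightarrow> 'x \<Rightarrow> 'x) \<Rightarrow> (nat \<Rightarrow> 'g set) \<Rightarrow> ('x \<Rightarrow> real) \<Rightarrow> ereal" where
  "b_upper T F f = (SUP x \<in> Reg T F f. ereal (lim (\<lambda>k. Avg T (F k) f x)))"

definition b_lower :: "('g \<Rightarrow> 'x \<Rightarrow> 'x) \<Rightarrow> (nat \<Rightarrow> 'g set) \<Rightarrow> ('x \<Rightarrow> real) \<Rightarrow> ereal" where
  "b_lower T F f = (INF x \<in> Reg T F f. ereal (lim (\<lambda>k. Avg T (F k) f x)))"

definition c_upper :: "('g \<Rightarrow> 'x \<Rightarrow> 'x) \<Rightarrow> (nat \<Rightarrow> 'g set) \<Rightarrow> ('x \<Rightarrow> real) \<Rightarrow> ereal" where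
  "c_upper T F f = (SUP x. limsup (\<lambda>k. ereal (Avg T (F k) f x)))"

definition c_lower :: "('g \<Rightarrow> 'x \<Rightarrow> 'x) \<Rightarrow> (nat \<Rightarrow> 'g set) \<Rightarrow> ('x \<Rightarrow> real) \<Rightarrow> ereal" where
  "c_lower T F f = (INF x. liminf (\<lambda>k. ereal (Avg T (F k) f x)))"

definition sup_Avg :: "('g \<Rightarrow> 'x \<Rightarrow> 'x) \<Rightarrow> (nat \<Rightarrow> 'g set) \<Rightarrow> ('x \<Rightarrow> real) \<Rightarrow> nat \<Rightarrow> ereal" where
  "sup_Avg T F f k = (SUP x. ereal (Avg T (F k) f x))"

definition inf_Avg :: "('g \<Rightarrow> 'x \<Rightarrow> 'x) \<Rightarrow> (nat \<Rightarrow> 'g set) \<Rightarrow> ('x \<Rightarrow> real) \<Rightarrow> nat \<Rightarrow> ereal" where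
  "inf_Avg T F f k = (INF x. ereal (Avg T (F k) f x))"

text \<open>\<^const>\<open>lim\<close> is meaningful only for convergent sequences, so convergence of
  \<open>sup_Avg T F f\<close> and \<open>inf_Avg T F f\<close> has to be asserted separately.\<close>

definition d_upper :: "('g \<Rightarrow> 'x \<Rightarrow> 'x) \<Rightarrow> (nat \<Rightarrow> 'g set) \<Rightarrow> ('x \<Rightarrow> real) \<Rightarrow> ereal" where
  "d_upper T F f = lim (sup_Avg T F f)"

definition d_lower :: "('g \<Rightarrow> 'x \<Rightarrow> 'x) \<Rightarrow> (nat \<Rightarrow> 'g set) \<Rightarrow> ('x \<Rightarrow> real) \<Rightarrow> ereal" where
  "d_lower T F f = lim (inf_Avg T F f)"

end

theory Submission
  imports Defs
begin

text \<open>Invariance of \<open>\<nu>\<close> gives \<open>\<integral>f \<partial>\<nu> = \<integral>Avg f \<partial>\<nu>\<close>, so the infimum of each average is at most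
  \<open>\<integral>f \<partial>\<nu>\<close>, and Fatou's lemma yields a point whose lower limit of averages is at most \<open>\<integral>f \<partial>\<nu>\<close>.
  Conversely, the averages at points where they are nearly minimal are integrals against empirical
  measures, any weak limit of which is invariant by the Foelner property. Finally \<open>\<integral>f \<partial>\<nu>\<close> attains
  its minimum at an extreme point. The upper values follow by passing to \<open>-f\<close>. Weak
  sequential compactness is obtained without the Riesz representation theorem, by reduction to
  Helly's selection theorem on the real line.\<close>

text \<open>A compact space that does not embed in the line has no continuous injective real code,
  so the code can only be Borel. The transported measures may then converge to a measure charging
  reals that code no point, which is why decoding has to make sense at every limit of codes.

  Fatou's lemma stands in for a pointwise ergodic theorem, which can fail along a general Foelner
  sequence. This is also why the values \<open>b_upper\<close> and \<open>b_lower\<close> join the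
  equalities only when typical points are assumed. Since these are assumed for ergodic measures
  alone, a minimizing invariant measure is not enough: the minimum must be found at an extreme
  point.

  Convergence of \<open>inf_Avg\<close> needs no monotonicity in the index: every single term is at
  most \<open>a_lower\<close>, and compactness bounds the lower limit from below by the same
  number.\<close>

section \<open>Coding a compact metrizable space by real numbers\<close>

lemma compact_metrizable_countable_base:
  assumes "compact (UNIV :: 'x::t2_space set)" and "metrizable_space (euclidean :: 'x::t2_space topology)"
  obtains B :: "nat \<Rightarrow> 'x::t2_space set" where "\<And>n. open (B n)"
    and "\<And>U x. open U \<Longrightarrow> x \<in> U \<Longrightarrow> \<exists>n. x \<in> B n \<and> B n \<subseteq> U"
proof -
  obtain M d where "Metric_space M d" and top: "(euclidean :: 'x topology) = Metric_space.mtopology M d"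
    using assms(2) unfolding metrizable_space_def by blast
  then interpret Metric_space M d by simp
  have M: "M = UNIV" using top topspace_mtopology by (metis topspace_euclidean)
  have op: "open U \<longleftrightarrow> openin mtopology U" for U :: "'x set"
    by (metis open_openin top)
  have ball: "open (mball x r)" for x r by (simp add: op)
  have "\<exists>C. finite C \<and> UNIV \<subseteq> (\<Union>x\<in>C. mball x (1 / Suc n))" for n :: nat
  proof -
    have "UNIV \<subseteq> (\<Union>x\<in>UNIV. mball x (1 / Suc n))" using centre_in_mball_iff by (fastforce simp: M)
    then show ?thesis using compactE_image[OF assms(1), of UNIV "\<lambda>x. mball x (1 / Suc n)"] ball by metis
  qed
  then obtain C where finC: "\<And>n. finite (C n)"
    and covC: "\<And>n. UNIV \<subseteq> (\<Union>x\<in>C n. mball x (1 / Suc n))" by metis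
  define \<B> where "\<B> = (\<Union>n. (\<lambda>x. mball x (1 / Suc n)) ` C n)"
  have cnt: "countable \<B>" unfolding \<B>_def by (rule countable_UN) (simp_all add: countable_finite finC)
  have ne: "\<B> \<noteq> {}"
  proof -
    have "C 0 \<noteq> {}" using covC[of 0] by auto
    then show ?thesis unfolding \<B>_def by auto
  qed
  show thesis
  proof (rule that[of "from_nat_into \<B>"])
    show "open (from_nat_into \<B> n)" for n
      using from_nat_into[OF ne, of n] unfolding \<B>_def by (auto simp: ball)
    fix U :: "'x set" and x assume "open U" "x \<in> U"
    then obtain r where r: "r > 0" "mball x r \<subseteq> U" by (auto simp: op openin_mtopology)
    obtain n where n: "1 / Suc n < r / 2"
      using nat_approx_posE[of "r/2"] r(1) by auto
    obtain c where c: "c \<in> C n" "x \<in> mball c (1 / Suc n)" using covC[of n] by blast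
    have "mball c (1 / Suc n) \<subseteq> U"
    proof
      fix y assume "y \<in> mball c (1 / Suc n)"
      then have "d x y < r" using c n triangle[of x c y] commute[of x c] by auto
      then have "y \<in> mball x r" unfolding in_mball by (simp add: M)
      then show "y \<in> U" using r(2) by auto
    qed
    moreover have "mball c (1 / Suc n) \<in> \<B>" using c(1) unfolding \<B>_def by auto
    then obtain m where "from_nat_into \<B> m = mball c (1 / Suc n)"
      using from_nat_into_surj[OF cnt] by blast
    ultimately show "\<exists>n. x \<in> from_nat_into \<B> n \<and> from_nat_into \<B> n \<subseteq> U"
      using c(2) by metis
  qed
qed

text \<open>The factor \<open>1/2\<close> is the gap between the leading digit and the sum of the tail.\<close>

lemma ternary_digits_agree:
  fixes a b :: "nat \<Rightarrow> real"
  assumes a: "\<And>n. a n \<in> {0, 1}" and b: "\<And>n. b n \<in> {0, 1}"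
    and lt: "\<bar>(\<Sum>n. a n * (1/3)^n) - (\<Sum>n. b n * (1/3)^n)\<bar> < (1/3)^N / 2" and "m \<le> N"
  shows "a m = b m"
proof (rule ccontr)
  assume "a m \<noteq> b m"
  define n where "n = (LEAST n. a n \<noteq> b n)"
  have n: "a n \<noteq> b n" "n \<le> m" and less: "\<And>i. i < n \<Longrightarrow> a i = b i"
    unfolding n_def using LeastI[of "\<lambda>n. a n \<noteq> b n", OF \<open>a m \<noteq> b m\<close>]
      Least_le[of "\<lambda>n. a n \<noteq> b n", OF \<open>a m \<noteq> b m\<close>] not_less_Least[of _ "\<lambda>n. a n \<noteq> b n"] by blast+
  have sum3: "summable (\<lambda>n. (1/3)^n :: real)" by (rule summable_geometric) auto
  have summ: "summable (\<lambda>n. u n * (1/3)^n)" if u: "\<And>n. u n \<in> {0, 1}" for u :: "nat \<Rightarrow> real"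
  proof (rule summable_comparison_test'[OF sum3, of 0])
    show "norm (u n * (1/3)^n) \<le> (1/3)^n" for n using u[of n] by auto
  qed
  note sa = summ[OF a] and sb = summ[OF b]
  define c where "c i = (a i - b i) * (1/3)^i" for i
  have sc: "summable c" unfolding c_def using summable_diff[OF sa sb] by (simp add: algebra_simps)
  have cb: "norm (c (i + Suc n)) \<le> (1/3)^Suc n * (1/3)^i" for i
    using a[of "i + Suc n"] b[of "i + Suc n"] by (auto simp: c_def abs_mult power_add)
  have s3: "summable (\<lambda>i. (1/3)^Suc n * (1/3)^i :: real)" by (intro summable_mult sum3)
  have "norm (\<Sum>i. c (i + Suc n)) \<le> (\<Sum>i. (1/3)^Suc n * (1/3)^i)"
    by (rule norm_suminf_le[OF cb s3])
  \<comment> \<open>The tail is (1/3)^(n+1) times the full geometric sum 3/2. In base 2 the tail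
    could cancel the leading digit completely (0111... = 1000...), so nearby values would not
    determine the digits.\<close>
  also have "\<dots> = (1/3)^n / 2"
    by (subst suminf_mult[OF sum3], subst suminf_geometric) auto
  finally have tail: "\<bar>\<Sum>i. c (i + Suc n)\<bar> \<le> (1/3)^n / 2" by simp
  have "(\<Sum>i. c i) = (\<Sum>i. c (i + Suc n)) + (\<Sum>i<Suc n. c i)"
    by (rule suminf_split_initial_segment[OF sc])
  also have "(\<Sum>i<Suc n. c i) = c n" using less by (simp add: c_def)
  finally have eq: "(\<Sum>i. c i) = (\<Sum>i. c (i + Suc n)) + c n" .
  have "\<bar>c n\<bar> = (1/3)^n" using n(1) a[of n] b[of n] by (auto simp: c_def abs_mult)
  then have "(1/3)^n / 2 \<le> \<bar>\<Sum>i. c i\<bar>" using tail eq by linarith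
  moreover have "(\<Sum>i. c i) = (\<Sum>n. a n * (1/3)^n) - (\<Sum>n. b n * (1/3)^n)"
    unfolding c_def suminf_diff[OF sa sb] by (simp add: algebra_simps)
  moreover have "(1/3::real)^N \<le> (1/3)^n" using n(2) \<open>m \<le> N\<close> by (intro power_decreasing) auto
  ultimately show False using lt by linarith
qed

text \<open>An open set in a metrizable space is an increasing union of closed sets
  \<open>C n\<close>. Urysohn functions equal to 1 on \<open>C n\<close> and 0 off \<open>U\<close>
  converge because each point of \<open>U\<close> eventually lies in \<open>C n\<close>. This is the
  bridge from integrals of continuous functions to measures of open sets.\<close>

lemma metrizable_indicator_open_limit:
  fixes U :: "'x::t2_space set"
  assumes "metrizable_space (euclidean :: 'x topology)" and "open U"
  obtains \<phi> :: "nat \<Rightarrow> 'x \<Rightarrow> real" where "\<And>n. continuous_on UNIV (\<phi> n)"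
    and "\<And>n x. 0 \<le> \<phi> n x" and "\<And>n x. \<phi> n x \<le> 1"
    and "\<And>x. (\<lambda>n. \<phi> n x) \<longlonglongrightarrow> indicat_real U x"
proof -
  have "fsigma_in euclidean U"
    using open_imp_fsigma_in[OF assms(1)] assms(2) by simp
  then obtain C :: "nat \<Rightarrow> 'x set" where C: "\<And>n. closed (C n)" "\<And>n. C n \<subseteq> C (Suc n)" "\<Union>(range C) = U"
    unfolding fsigma_in_ascending by auto
  have "\<exists>\<phi>. continuous_map euclidean (top_of_set {0..1::real}) \<phi> \<and> \<phi> ` (- U) \<subseteq> {0} \<and> \<phi> ` C n \<subseteq> {1}" for n
  proof (rule Urysohn_lemma[of euclidean "- U" "C n" 0 1])
    show "normal_space (euclidean :: 'x topology)" by (rule metrizable_imp_normal_space[OF assms(1)])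
    show "disjnt (- U) (C n)" using C(3) by (auto simp: disjnt_def)
  qed (use C assms(2) in auto)
  then obtain \<phi> where \<phi>: "\<And>n. continuous_map euclidean (top_of_set {0..1::real}) (\<phi> n)"
     "\<And>n. \<phi> n ` (- U) \<subseteq> {0}" "\<And>n. \<phi> n ` C n \<subseteq> {1}" by metis
  show thesis
  proof (rule that[of \<phi>])
    show "continuous_on UNIV (\<phi> n)" for n using \<phi>(1)[of n] by (simp add: continuous_map_in_subtopology)
    show "0 \<le> \<phi> n x" "\<phi> n x \<le> 1" for n x using \<phi>(1)[of n] by (auto simp: continuous_map_in_subtopology)
    fix x
    show "(\<lambda>n. \<phi> n x) \<longlonglongrightarrow> indicat_real U x"
    proof (cases "x \<in> U")
      case True
      then obtain m where "x \<in> C m" using C(3) by auto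
      have "\<phi> n x = 1" if "n \<ge> m" for n
      proof -
        have "C m \<subseteq> C n" using C(2) that by (rule lift_Suc_mono_le)
        then have "\<phi> n x \<in> \<phi> n ` C n" using \<open>x \<in> C m\<close> by blast
        then show ?thesis using \<phi>(3)[of n] by blast
      qed
      then have "eventually (\<lambda>n. \<phi> n x = indicat_real U x) sequentially"
        using True by (auto intro!: eventually_sequentiallyI[of m])
      then show ?thesis by (rule tendsto_eventually)
    next
      case False
      then have "\<phi> n x = 0" for n using \<phi>(2)[of n] by auto
      then show ?thesis using False by simp
    qed
  qed
qed

text \<open>The code of \<open>x\<close> is the real number whose ternary digits record membership of \<open>x\<close> in the
  sets of a countable base. It is not continuous, but every continuous function is uniformly
  continuous with respect to it. The object-level quantifier over \<open>g\<close> avoids higher-order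
  unification in uses of this property.\<close>

lemma compact_metrizable_real_coding:
  assumes "compact (UNIV :: 'x::t2_space set)" and "metrizable_space (euclidean :: 'x::t2_space topology)"
  obtains s :: "'x::t2_space \<Rightarrow> real" where "s \<in> borel_measurable borel" and "\<forall>x. \<bar>s x\<bar> \<le> 2"
    and "\<forall>(g :: 'x \<Rightarrow> real) e. continuous_on UNIV g \<longrightarrow> e > 0 \<longrightarrow>
           (\<exists>\<delta>>0. \<forall>x y. \<bar>s x - s y\<bar> < \<delta> \<longrightarrow> \<bar>g x - g y\<bar> < e)"
proof -
  obtain B :: "nat \<Rightarrow> 'x set" where B: "\<And>n. open (B n)"
    "\<And>U x. open U \<Longrightarrow> x \<in> U \<Longrightarrow> \<exists>n. x \<in> B n \<and> B n \<subseteq> U"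
    using compact_metrizable_countable_base[OF assms] by blast
  define s where "s x = (\<Sum>n. indicat_real (B n) x * (1/3)^n)" for x
  have sum3: "summable (\<lambda>n. (1/3)^n :: real)" by (rule summable_geometric) auto
  show thesis
  proof (rule that[of s])
    have "B n \<in> sets borel" for n using B(1) by simp
    then show "s \<in> borel_measurable borel" unfolding s_def by measurable
    show "\<forall>x. \<bar>s x\<bar> \<le> 2"
    proof
      fix x
      have "norm (s x) \<le> (\<Sum>n. (1/3)^n)"
        unfolding s_def by (rule norm_suminf_le[OF _ sum3]) (auto simp: indicator_def)
      also have "(\<Sum>n. (1/3::real)^n) \<le> 2" by (subst suminf_geometric) auto
      finally show "\<bar>s x\<bar> \<le> 2" by simp
    qed
    show "\<forall>(g :: 'x \<Rightarrow> real) e. continuous_on UNIV g \<longrightarrow> e > 0 \<longrightarrow>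
           (\<exists>\<delta>>0. \<forall>x y. \<bar>s x - s y\<bar> < \<delta> \<longrightarrow> \<bar>g x - g y\<bar> < e)"
    proof (intro allI impI)
      fix g :: "'x \<Rightarrow> real" and e :: real assume g: "continuous_on UNIV g" and e: "e > 0"
      have "\<exists>n. p \<in> B n \<and> B n \<subseteq> {x. \<bar>g x - g p\<bar> < e / 2}" for p
      proof (rule B(2))
        show "open {x. \<bar>g x - g p\<bar> < e / 2}" using g by (intro open_Collect_less continuous_intros)
      qed (use e in auto)
      then obtain i where i: "\<And>p. p \<in> B (i p)" "\<And>p. B (i p) \<subseteq> {x. \<bar>g x - g p\<bar> < e / 2}" by metis
      obtain P where P: "finite P" "UNIV \<subseteq> (\<Union>p\<in>P. B (i p))"
        by (rule compactE_image[OF assms(1), of UNIV "\<lambda>p. B (i p)"]) (use B i in auto)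
      \<comment> \<open>The finitely many base sets \<open>B (i p)\<close> cover the space and
        \<open>g\<close> varies little on each. Codes that agree up to digit \<open>N\<close> decide
        membership in all of them, so both points lie in a common one.\<close>
      define N where "N = Max (i ` P)"
      show "\<exists>\<delta>>0. \<forall>x y. \<bar>s x - s y\<bar> < \<delta> \<longrightarrow> \<bar>g x - g y\<bar> < e"
      proof (intro exI[of _ "(1/3)^N / 2"] conjI allI impI)
        fix x y assume xy: "\<bar>s x - s y\<bar> < (1/3)^N / 2"
        obtain p where p: "p \<in> P" "x \<in> B (i p)" using P(2) by auto
        have "i p \<le> N" unfolding N_def using P(1) p(1) by simp
        then have "indicat_real (B (i p)) x = indicat_real (B (i p)) y"
          by (intro ternary_digits_agree[OF _ _ xy[unfolded s_def]]) (auto simp: indicator_def)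
        then have "y \<in> B (i p)" using p(2) by (auto simp: indicator_def split: if_splits)
        then have "\<bar>g x - g p\<bar> < e / 2" "\<bar>g y - g p\<bar> < e / 2" using p i(2)[of p] by auto
        then show "\<bar>g x - g y\<bar> < e" by linarith
      qed simp
    qed
  qed
qed

text \<open>Decoding extends from codes to limits of codes: \<open>p r\<close> is a point that lies, for every
  \<open>\<delta>\<close>, in the closure of the set of points with code \<open>\<delta>\<close>-close to \<open>r\<close>.\<close>

lemma compact_metrizable_real_decoding:
  fixes s :: "'x::t2_space \<Rightarrow> real"
  assumes comp: "compact (UNIV :: 'x set)"
    and unif: "\<forall>(g :: 'x \<Rightarrow> real) e. continuous_on UNIV g \<longrightarrow> e > 0 \<longrightarrow>
           (\<exists>\<delta>>0. \<forall>x y. \<bar>s x - s y\<bar> < \<delta> \<longrightarrow> \<bar>g x - g y\<bar> < e)"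
  obtains p :: "real \<Rightarrow> 'x"
  where "\<forall>g :: 'x \<Rightarrow> real. continuous_on UNIV g \<longrightarrow> continuous_on (closure (range s)) (g \<circ> p)"
    and "\<forall>g :: 'x \<Rightarrow> real. continuous_on UNIV g \<longrightarrow> g \<circ> p \<circ> s = g"
proof -
  note s = unif[rule_format]
  define A where "A r \<delta> = closure {x. \<bar>s x - r\<bar> < \<delta>}" for r \<delta>
  have Amono: "\<delta> \<le> \<delta>' \<Longrightarrow> A r \<delta> \<subseteq> A r \<delta>'" for r \<delta> \<delta>' unfolding A_def by (rule closure_mono) auto
  have "\<exists>q. \<forall>\<delta>>0. q \<in> A r \<delta>" if r: "r \<in> closure (range s)" for r
  proof -
    have ne: "A r \<delta> \<noteq> {}" if \<delta>: "\<delta> > 0" for \<delta>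
    proof -
      obtain x where "\<bar>s x - r\<bar> < \<delta>"
        using r \<delta> unfolding closure_approachable dist_real_def by blast
      then have "x \<in> A r \<delta>" unfolding A_def by (intro subsetD[OF closure_subset]) simp
      then show ?thesis by blast
    qed
    have "UNIV \<inter> \<Inter>(A r ` {0<..}) \<noteq> {}"
    proof (rule compact_imp_fip[OF comp])
      show "closed T" if "T \<in> A r ` {0<..}" for T using that by (auto simp: A_def)
      fix F' assume "finite F'" "F' \<subseteq> A r ` {0<..}"
      then obtain D where D: "D \<subseteq> {0<..}" "finite D" "F' = A r ` D"
        using finite_subset_image[OF \<open>finite F'\<close> \<open>F' \<subseteq> A r ` {0<..}\<close>] by blast
      \<comment> \<open>The sets \<open>A r\<close> are nested, so the smallest radius serves the
        whole finite family; the extra 1 covers the case of empty \<open>D\<close>.\<close>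
      have "Min (insert 1 D) > 0" using D by (subst Min_gr_iff) auto
      then obtain q where q: "q \<in> A r (Min (insert 1 D))" using ne by blast
      have "A r (Min (insert 1 D)) \<subseteq> A r \<delta>" if "\<delta> \<in> D" for \<delta>
        using D(2) that by (intro Amono Min_le) auto
      with q have "q \<in> \<Inter>F'" unfolding D(3) by blast
      then show "UNIV \<inter> \<Inter>F' \<noteq> {}" by blast
    qed
    then obtain q where "q \<in> \<Inter>(A r ` {0<..})" by blast
    then show ?thesis by (intro exI[of _ q]) simp
  qed
  then have "\<forall>r\<in>closure (range s). \<exists>q. \<forall>\<delta>>0. q \<in> A r \<delta>" by blast
  from bchoice[OF this] obtain p
    where p': "\<forall>r\<in>closure (range s). \<forall>\<delta>>0. p r \<in> A r \<delta>" ..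
  have p: "p r \<in> A r \<delta>" if "r \<in> closure (range s)" "\<delta> > 0" for r \<delta>
    using p' that by blast
  \<comment> \<open>A neighbourhood of \<open>p r\<close> on which \<open>g\<close> varies by less
    than \<open>e\<close> meets the closure of the points with code near \<open>r\<close>; being
    open, it meets the set itself.\<close>
  have near: "\<exists>x. \<bar>s x - r\<bar> < \<delta> \<and> \<bar>g x - g (p r)\<bar> < e"
    if "continuous_on UNIV g" "r \<in> closure (range s)" "\<delta> > 0" "e > 0" for g :: "'x \<Rightarrow> real" and r \<delta> e
  proof -
    have "open {x. \<bar>g x - g (p r)\<bar> < e}" using that(1) by (intro open_Collect_less continuous_intros)
    moreover have "p r \<in> {x. \<bar>g x - g (p r)\<bar> < e}" using that by simp
    ultimately have "{x. \<bar>s x - r\<bar> < \<delta>} \<inter> {x. \<bar>g x - g (p r)\<bar> < e} \<noteq> {}"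
      using p[OF that(2,3)] unfolding A_def
      by (metis (no_types, lifting) IntI emptyE inf_commute open_Int_closure_eq_empty)
    then show ?thesis by blast
  qed
  have cont: "continuous_on (closure (range s)) (g \<circ> p)" if g: "continuous_on UNIV g" for g :: "'x \<Rightarrow> real"
  proof (rule continuous_onI)
    fix r and e :: real assume r: "r \<in> closure (range s)" and e: "e > 0"
    then have e3: "e / 3 > 0" by simp
    obtain \<delta> where \<delta>: "\<delta> > 0" "\<And>x y. \<bar>s x - s y\<bar> < \<delta> \<Longrightarrow> \<bar>g x - g y\<bar> < e/3" using s[OF g e3] by blast
    \<comment> \<open>Thirds, because the codes are compared along the path from \<open>s x\<close>
      to \<open>r\<close> to \<open>r'\<close> to \<open>s x'\<close>, and the values of
      \<open>g\<close> along a path of the same length.\<close>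
    have d3: "\<delta> / 3 > 0" using \<delta>(1) by simp
    show "\<exists>d>0. \<forall>x'\<in>closure (range s). dist x' r < d \<longrightarrow> dist ((g \<circ> p) x') ((g \<circ> p) r) \<le> e"
    proof (intro exI[of _ "\<delta>/3"] conjI ballI impI)
      fix r' assume r': "r' \<in> closure (range s)" "dist r' r < \<delta>/3"
      obtain x where x: "\<bar>s x - r\<bar> < \<delta>/3" "\<bar>g x - g (p r)\<bar> < e/3" using near[OF g r d3 e3] by blast
      obtain x' where x': "\<bar>s x' - r'\<bar> < \<delta>/3" "\<bar>g x' - g (p r')\<bar> < e/3" using near[OF g r'(1) d3 e3] by blast
      have "\<bar>s x - s x'\<bar> < \<delta>" using x(1) x'(1) r'(2) unfolding dist_real_def by linarith
      from \<delta>(2)[OF this] show "dist ((g \<circ> p) r') ((g \<circ> p) r) \<le> e"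
        using x(2) x'(2) unfolding dist_real_def comp_def by linarith
    qed (rule d3)
  qed
  have val: "g \<circ> p \<circ> s = g" if g: "continuous_on UNIV g" for g :: "'x \<Rightarrow> real"
  proof
    fix x
    have r: "s x \<in> closure (range s)" by (intro subsetD[OF closure_subset]) simp
    have "\<bar>g (p (s x)) - g x\<bar> < e" if e: "e > 0" for e
    proof -
      obtain \<delta> where \<delta>: "\<delta> > 0" "\<And>x y. \<bar>s x - s y\<bar> < \<delta> \<Longrightarrow> \<bar>g x - g y\<bar> < e/2"
        using s[OF g half_gt_zero[OF e]] by blast
      obtain y where y: "\<bar>s y - s x\<bar> < \<delta>" "\<bar>g y - g (p (s x))\<bar> < e/2"
        using near[OF g r \<delta>(1) half_gt_zero[OF e]] by blast
      show ?thesis using \<delta>(2)[OF y(1)] y(2) by linarith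
    qed
    from this[of "\<bar>g (p (s x)) - g x\<bar>"] show "(g \<circ> p \<circ> s) x = g x" by force
  qed
  show thesis by (rule that[of p]) (intro allI impI cont val, assumption)+
qed

section \<open>Weak convergence of Borel probability measures\<close>

definition borel_probs :: "'x::topological_space measure set" where
  "borel_probs = {\<mu>. prob_space \<mu> \<and> sets \<mu> = sets borel}"

text \<open>The test functions carry no boundedness condition: on the compact spaces considered here
  it is automatic.\<close>

definition weakly_tendsto :: "(nat \<Rightarrow> 'x::topological_space measure) \<Rightarrow> 'x measure \<Rightarrow> bool" where
  "weakly_tendsto \<nu> \<mu> \<longleftrightarrow>
     (\<forall>g :: 'x \<Rightarrow> real. continuous_on UNIV g \<longrightarrow> (\<lambda>n. \<integral>x. g x \<partial>\<nu> n) \<longlonglongrightarrow> (\<integral>x. g x \<partial>\<mu>))"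

lemma weakly_tendstoD:
  fixes g :: "'x::topological_space \<Rightarrow> real"
  shows "weakly_tendsto \<nu> \<mu> \<Longrightarrow> continuous_on UNIV g \<Longrightarrow> (\<lambda>n. \<integral>x. g x \<partial>\<nu> n) \<longlonglongrightarrow> (\<integral>x. g x \<partial>\<mu>)"
  by (simp add: weakly_tendsto_def)

lemma compact_continuous_bounded:
  fixes g :: "'x::topological_space \<Rightarrow> real"
  assumes "compact (UNIV :: 'x set)" and "continuous_on UNIV g"
  obtains B where "B \<ge> 0" and "\<And>x. \<bar>g x\<bar> \<le> B"
proof -
  have "bounded (range g)"
    using assms by (intro compact_imp_bounded compact_continuous_image)
  then obtain B where B: "B > 0" "\<forall>y\<in>range g. norm y \<le> B" unfolding bounded_pos by blast
  show thesis by (rule that[of B]) (use B in auto)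
qed

lemma borel_probs_continuous_measurable:
  assumes "\<mu> \<in> borel_probs" and "continuous_on UNIV h"
  shows "h \<in> borel_measurable \<mu>"
proof -
  have "sets \<mu> = sets borel" using assms(1) by (simp add: borel_probs_def)
  then show ?thesis
    using borel_measurable_continuous_onI[OF assms(2)] measurable_cong_sets[OF _ refl] by blast
qed

lemma borel_probs_integrable:
  fixes g :: "'x::topological_space \<Rightarrow> real"
  assumes "\<mu> \<in> borel_probs" and "g \<in> borel_measurable borel" and "\<And>x. \<bar>g x\<bar> \<le> B"
  shows "integrable \<mu> g"
proof -
  interpret prob_space \<mu> using assms(1) by (simp add: borel_probs_def)
  have [measurable_cong]: "sets \<mu> = sets borel" using assms(1) by (simp add: borel_probs_def)
  show ?thesis
    by (rule integrable_const_bound[where B=B]) (use assms in \<open>auto intro!: AE_I2\<close>)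
qed

lemma borel_probs_integral_bound:
  fixes g :: "'x::topological_space \<Rightarrow> real"
  assumes "\<mu> \<in> borel_probs" and "g \<in> borel_measurable borel" and "\<And>x. \<bar>g x\<bar> \<le> B"
  shows "\<bar>\<integral>x. g x \<partial>\<mu>\<bar> \<le> B"
proof -
  interpret prob_space \<mu> using assms(1) by (simp add: borel_probs_def)
  have i: "integrable \<mu> g" by (rule borel_probs_integrable[OF assms])
  have "\<integral>x. g x \<partial>\<mu> \<le> B" "- B \<le> \<integral>x. g x \<partial>\<mu>"
    using assms(3) by (auto intro!: integral_le_const integral_ge_const i AE_I2 simp: abs_le_iff minus_le_iff)
  then show ?thesis by linarith
qed

text \<open>The decoding is obtained by choice and is controlled only through continuous real
  functions. Approximating the indicator of an open set by such functions makes its composition with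
  the map a pointwise limit of functions continuous on \<open>K\<close> and constant off
  \<open>K\<close>.\<close>

lemma metrizable_borel_measurable_if_continuous_comp:
  fixes p :: "real \<Rightarrow> 'x::t2_space"
  assumes "metrizable_space (euclidean :: 'x topology)" and "closed K"
    and p: "\<And>g :: 'x \<Rightarrow> real. continuous_on UNIV g \<Longrightarrow> continuous_on K (g \<circ> p)"
  shows "(\<lambda>r. if r \<in> K then p r else c) \<in> borel_measurable borel"
proof (rule borel_measurableI)
  fix U :: "'x set" assume "open U"
  let ?q = "\<lambda>r. if r \<in> K then p r else c"
  obtain \<phi> :: "nat \<Rightarrow> 'x \<Rightarrow> real" where \<phi>: "\<And>n. continuous_on UNIV (\<phi> n)"
    "\<And>x. (\<lambda>n. \<phi> n x) \<longlonglongrightarrow> indicat_real U x"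
    using metrizable_indicator_open_limit[OF assms(1) \<open>open U\<close>] by metis
  have "(\<lambda>r. if r \<in> K then (\<phi> n \<circ> p) r else \<phi> n c) \<in> borel_measurable borel" for n
    using assms(2) by (intro borel_measurable_continuous_on_if p \<phi>(1) continuous_on_const) simp
  then have "(\<lambda>r. \<phi> n (?q r)) \<in> borel_measurable borel" for n
    by (simp add: if_distrib comp_def cong: if_cong)
  then have "(\<lambda>r. indicat_real U (?q r)) \<in> borel_measurable borel"
    by (rule borel_measurable_LIMSEQ_real[rotated]) (rule \<phi>(2))
  then have "(\<lambda>r. indicat_real U (?q r)) -` {1} \<inter> space borel \<in> sets borel"
    by (rule measurable_sets) simp
  moreover have "(\<lambda>r. indicat_real U (?q r)) -` {1} \<inter> space borel = ?q -` U \<inter> space borel"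
    by (auto simp: indicator_def split: if_splits)
  ultimately show "?q -` U \<inter> space borel \<in> sets borel" by simp
qed

text \<open>The measures are transported to the real line by the coding, where Helly selection applies;
  the limit lives on the closed set of limits of codes and is transported back by the decoding.\<close>

lemma borel_probs_weakly_sequentially_compact:
  fixes \<nu> :: "nat \<Rightarrow> 'x::t2_space measure"
  assumes comp: "compact (UNIV :: 'x set)" and metr: "metrizable_space (euclidean :: 'x topology)"
    and \<nu>: "\<And>n. \<nu> n \<in> borel_probs"
  obtains r \<mu> where "strict_mono (r :: nat \<Rightarrow> nat)" and "\<mu> \<in> borel_probs" and "weakly_tendsto (\<nu> \<circ> r) \<mu>"
proof -
  obtain s :: "'x \<Rightarrow> real" where s_meas: "s \<in> borel_measurable borel" and s_bd: "\<forall>x. \<bar>s x\<bar> \<le> 2"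
    and s_unif: "\<forall>(g :: 'x \<Rightarrow> real) e. continuous_on UNIV g \<longrightarrow> e > 0 \<longrightarrow>
           (\<exists>\<delta>>0. \<forall>x y. \<bar>s x - s y\<bar> < \<delta> \<longrightarrow> \<bar>g x - g y\<bar> < e)"
    by (rule compact_metrizable_real_coding[OF comp metr])
  define K where "K = closure (range s)"
  have K: "closed K" "K \<noteq> {}" "\<And>x. s x \<in> K"
    unfolding K_def by (auto intro!: subsetD[OF closure_subset])
  obtain p :: "real \<Rightarrow> 'x" where
    p: "\<forall>g :: 'x \<Rightarrow> real. continuous_on UNIV g \<longrightarrow> continuous_on K (g \<circ> p)"
       "\<forall>g :: 'x \<Rightarrow> real. continuous_on UNIV g \<longrightarrow> g \<circ> p \<circ> s = g"
    unfolding K_def by (rule compact_metrizable_real_decoding[OF comp s_unif])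
  note p_cont = p(1)[rule_format] and p_s = p(2)[rule_format]
  \<comment> \<open>The value off \<open>K\<close> is arbitrary, since the limit measure will be
    shown to be carried by \<open>K\<close>.\<close>
  define q where "q r = (if r \<in> K then p r else undefined)" for r
  have q_meas: "q \<in> borel_measurable borel"
    unfolding q_def by (rule metrizable_borel_measurable_if_continuous_comp[OF metr K(1) p_cont])
  have prob: "prob_space (\<nu> n)" and sets_\<nu>: "sets (\<nu> n) = sets borel" for n
    using \<nu>[of n] by (auto simp: borel_probs_def)
  have s_meas': "s \<in> borel_measurable (\<nu> n)" for n
    using s_meas measurable_cong_sets[OF sets_\<nu> refl] by blast
  define \<rho> where "\<rho> n = distr (\<nu> n) borel s" for n
  have rd: "real_distribution (\<rho> n)" for n
    unfolding \<rho>_def real_distribution_def real_distribution_axioms_def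
    by (simp add: prob_space.prob_space_distr[OF prob s_meas'])
  have int_\<rho>: "(\<integral>r. h r \<partial>\<rho> n) = (\<integral>x. h (s x) \<partial>\<nu> n)" if "h \<in> borel_measurable borel" for h :: "real \<Rightarrow> real" and n
    unfolding \<rho>_def by (rule integral_distr[OF s_meas' that])
  \<comment> \<open>Codes lie in [-2, 2], so one bounded interval carries all the measures;
    half-open is the form in which \<open>tight\<close> is stated.\<close>
  have "measure (\<rho> n) {-3<..3} = 1" for n
  proof -
    have "measure (\<rho> n) {-3<..3} = measure (\<nu> n) (s -` {-3<..3} \<inter> space (\<nu> n))"
      unfolding \<rho>_def by (rule measure_distr[OF s_meas']) simp
    moreover have "s x \<in> {-3<..3}" for x using s_bd[rule_format, of x] by auto
    then have "s -` {-3<..3} \<inter> space (\<nu> n) = space (\<nu> n)" by blast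
    ultimately show ?thesis using prob_space.prob_space[OF prob] by simp
  qed
  then have "tight \<rho>"
    unfolding tight_def
  proof (intro conjI allI impI)
    fix \<epsilon> :: real assume "\<epsilon> > 0"
    then show "\<exists>a b. a < b \<and> (\<forall>n. measure (\<rho> n) {a<..b} > 1 - \<epsilon>)"
      using \<open>\<And>n. measure (\<rho> n) {-3<..3} = 1\<close> by (intro exI[of _ "-3"] exI[of _ "3"]) simp
  qed (rule rd)
  from tight_imp_convergent_subsubsequence[OF this strict_mono_id]
  obtain r M where r: "strict_mono (r :: nat \<Rightarrow> nat)" and M: "real_distribution M"
    and conv: "weak_conv_m (\<rho> \<circ> r) M" by auto
  interpret M: real_distribution M by fact
  have conv': "(\<lambda>n. \<integral>x. h (s x) \<partial>\<nu> (r n)) \<longlonglongrightarrow> (\<integral>r. h r \<partial>M)"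
    if h: "continuous_on UNIV h" "\<And>r. \<bar>h r\<bar> \<le> B" for h :: "real \<Rightarrow> real" and B
  proof -
    have "(\<lambda>n. \<integral>r. h r \<partial>(\<rho> \<circ> r) n) \<longlonglongrightarrow> (\<integral>r. h r \<partial>M)"
    proof (rule weak_conv_imp_integral_bdd_continuous_conv[OF _ M conv])
      show "isCont h x" for x using h(1) by (simp add: continuous_on_eq_continuous_at)
    qed (use rd h(2) in auto)
    moreover have "h \<in> borel_measurable borel" using h(1) by (rule borel_measurable_continuous_onI)
    ultimately show ?thesis by (simp add: int_\<rho>)
  qed
  have AE_K: "AE r in M. r \<in> K"
  proof -
    \<comment> \<open>A bounded continuous function vanishing exactly on \<open>K\<close>. Its
      integral is 0 before the limit, hence also against \<open>M\<close>.\<close>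
    let ?k = "\<lambda>r. min 1 (infdist r K)"
    have k: "continuous_on UNIV ?k" by (intro continuous_intros)
    have "(\<integral>r. ?k r \<partial>M) = 0"
    proof (rule LIMSEQ_unique[OF conv'[OF k]])
      show "\<bar>?k r\<bar> \<le> 1" for r using infdist_nonneg[of r K] by auto
      show "(\<lambda>n. \<integral>x. ?k (s x) \<partial>\<nu> (r n)) \<longlonglongrightarrow> 0" using K(3) by (simp add: infdist_zero)
    qed
    moreover have "integrable M ?k"
      using borel_measurable_continuous_onI[OF k]
      by (intro M.integrable_const_bound[where B=1]) (auto simp: infdist_nonneg)
    ultimately have "AE r in M. ?k r = 0"
      using integral_nonneg_eq_0_iff_AE[of M ?k] by (auto simp: infdist_nonneg)
    then show ?thesis
      by eventually_elim (use in_closed_iff_infdist_zero[OF K(1,2)] in \<open>auto simp: min_def split: if_splits\<close>)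
  qed
  define \<mu> where "\<mu> = distr M borel q"
  have q_M: "q \<in> measurable M borel" using q_meas by simp
  have \<mu>: "\<mu> \<in> borel_probs"
    unfolding \<mu>_def borel_probs_def using M.prob_space_distr[OF q_M] by simp
  have "weakly_tendsto (\<nu> \<circ> r) \<mu>"
    unfolding weakly_tendsto_def
  proof (intro allI impI)
    fix g :: "'x \<Rightarrow> real" assume g: "continuous_on UNIV g"
    obtain B where B: "B \<ge> 0" "\<And>x. \<bar>g x\<bar> \<le> B" using compact_continuous_bounded[OF comp g] by blast
    \<comment> \<open>Weak convergence on the line tests functions continuous everywhere, while
      \<open>g \<circ> p\<close> is continuous only on \<open>K\<close>. The extension agrees with
      \<open>g\<close> at all codes and keeps the bound \<open>B\<close>.\<close>
    obtain h :: "real \<Rightarrow> real" where h: "continuous_on UNIV h" "\<And>r. r \<in> K \<Longrightarrow> h r = (g \<circ> p) r"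
      "\<And>r. r \<in> UNIV \<Longrightarrow> norm (h r) \<le> B"
      by (rule Tietze[OF p_cont[OF g], of UNIV B]) (use B K(1) in auto)
    have hs: "h (s x) = g x" for x using h(2)[OF K(3), of x] fun_cong[OF p_s[OF g], of x] by simp
    have g_meas: "g \<in> borel_measurable borel" using g by (rule borel_measurable_continuous_onI)
    have h_meas: "h \<in> borel_measurable borel" using h(1) by (rule borel_measurable_continuous_onI)
    have "(\<integral>x. g x \<partial>\<mu>) = (\<integral>r. g (q r) \<partial>M)"
      unfolding \<mu>_def by (rule integral_distr[OF q_M g_meas])
    also have "\<dots> = (\<integral>r. h r \<partial>M)"
    proof (rule integral_cong_AE)
      show "(\<lambda>r. g (q r)) \<in> borel_measurable M" using measurable_compose[OF q_M g_meas] .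
      show "h \<in> borel_measurable M" using h_meas by simp
      show "AE r in M. g (q r) = h r" using AE_K by eventually_elim (simp add: q_def h(2))
    qed
    finally have "(\<integral>x. g x \<partial>\<mu>) = (\<integral>r. h r \<partial>M)" .
    with conv'[OF h(1), of B] h(3) show "(\<lambda>n. \<integral>x. g x \<partial>(\<nu> \<circ> r) n) \<longlonglongrightarrow> (\<integral>x. g x \<partial>\<mu>)"
      by (simp add: hs)
  qed
  with r \<mu> show thesis by (rule that)
qed

section \<open>Separating measures by countably many integrals, and attaining minima\<close>

lemma borel_probs_measure_open_limit:
  assumes "\<mu> \<in> borel_probs" and "open U" and "\<And>n. continuous_on UNIV (\<phi> n)"
    and "\<And>n x. 0 \<le> \<phi> n x" and "\<And>n x. \<phi> n x \<le> (1::real)" and "\<And>x. (\<lambda>n. \<phi> n x) \<longlonglongrightarrow> indicat_real U x"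
  shows "(\<lambda>n. \<integral>x. \<phi> n x \<partial>\<mu>) \<longlonglongrightarrow> measure \<mu> U"
proof -
  interpret prob_space \<mu> using assms(1) by (simp add: borel_probs_def)
  have m: "\<phi> n \<in> borel_measurable \<mu>" for n
    by (rule borel_probs_continuous_measurable[OF assms(1,3)])
  have U: "U \<in> sets \<mu>" using assms(1,2) by (simp add: borel_probs_def)
  have "(\<lambda>n. \<integral>x. \<phi> n x \<partial>\<mu>) \<longlonglongrightarrow> (\<integral>x. indicat_real U x \<partial>\<mu>)"
  proof (rule integral_dominated_convergence[where w="\<lambda>_. 1"])
    show "AE x in \<mu>. (\<lambda>n. \<phi> n x) \<longlonglongrightarrow> indicat_real U x" using assms(6) by simp
    show "AE x in \<mu>. norm (\<phi> n x) \<le> 1" for n using assms(4,5) by simp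
  qed (use m U in auto)
  then show ?thesis using U sets.Int_space_eq2[OF U] by simp
qed

text \<open>Finite intersections of base sets are a countable generator of the Borel sets closed
  under intersection, and the measure of each is a limit of integrals of continuous functions.
  Countability later lets a single convergent series detect equality of measures.\<close>

lemma compact_metrizable_separating_sequence:
  assumes comp: "compact (UNIV :: 'x::t2_space set)" and metr: "metrizable_space (euclidean :: 'x::t2_space topology)"
  obtains \<phi> :: "nat \<Rightarrow> 'x::t2_space \<Rightarrow> real" where "\<forall>n. continuous_on UNIV (\<phi> n)"
    and "\<forall>n x. 0 \<le> \<phi> n x \<and> \<phi> n x \<le> 1"
    and "\<forall>\<mu>\<in>borel_probs. \<forall>\<nu>\<in>borel_probs. (\<forall>n. (\<integral>x. \<phi> n x \<partial>\<mu>) = (\<integral>x. \<phi> n x \<partial>\<nu>)) \<longrightarrow> \<mu> = \<nu>"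
proof -
  obtain B :: "nat \<Rightarrow> 'x set" where B: "\<And>n. open (B n)"
    "\<And>U x. open U \<Longrightarrow> x \<in> U \<Longrightarrow> \<exists>n. x \<in> B n \<and> B n \<subseteq> U"
    using compact_metrizable_countable_base[OF comp metr] by blast
  \<comment> \<open>Index lists coded as numbers: concatenation gives closure under intersection,
    and the empty list gives the whole space, required as a cover by generators of finite
    measure.\<close>
  define D where "D k = (\<Inter>i\<in>set (from_nat k :: nat list). B i)" for k
  have openD: "open (D k)" for k unfolding D_def by (intro open_INT ballI B(1)) simp
  have "\<exists>\<psi> :: nat \<Rightarrow> 'x \<Rightarrow> real. (\<forall>n. continuous_on UNIV (\<psi> n)) \<and> (\<forall>n x. 0 \<le> \<psi> n x \<and> \<psi> n x \<le> 1) \<and>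
          (\<forall>x. (\<lambda>n. \<psi> n x) \<longlonglongrightarrow> indicat_real (D k) x)" for k
    by (rule metrizable_indicator_open_limit[OF metr openD[of k]]) blast
  then obtain \<psi> :: "nat \<Rightarrow> nat \<Rightarrow> 'x \<Rightarrow> real" where \<psi>: "\<And>k n. continuous_on UNIV (\<psi> k n)"
     "\<And>k n x. 0 \<le> \<psi> k n x" "\<And>k n x. \<psi> k n x \<le> 1"
     "\<And>k x. (\<lambda>n. \<psi> k n x) \<longlonglongrightarrow> indicat_real (D k) x" by metis
  have Int: "Int_stable (range D)"
  proof (rule Int_stableI)
    fix a b assume "a \<in> range D" "b \<in> range D"
    then obtain k l where "a = D k" "b = D l" by blast
    then have "a \<inter> b = D (to_nat (from_nat k @ from_nat l :: nat list))" by (auto simp: D_def)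
    then show "a \<inter> b \<in> range D" by blast
  qed
  have gen: "sets (borel :: 'x measure) = sigma_sets UNIV (range D)"
  proof -
    have "sigma_sets UNIV {S :: 'x set. open S} = sigma_sets UNIV (range D)"
    proof (rule sigma_sets_eqI)
      fix U :: "'x set" assume "U \<in> {S. open S}"
      then have U: "open U" by simp
      have BD: "B n = D (to_nat [n])" for n by (simp add: D_def)
      have "U = (\<Union>n\<in>{n. B n \<subseteq> U}. B n)" using B(2)[OF U] by blast
      also have "\<dots> = (\<Union>n. if B n \<subseteq> U then B n else {})" by auto
      also have "\<dots> \<in> sigma_sets UNIV (range D)"
        by (rule sigma_sets.Union) (auto simp: BD intro: sigma_sets.Empty)
      finally show "U \<in> sigma_sets UNIV (range D)" .
    qed (auto simp: openD)
    then show ?thesis by (simp add: borel_def)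
  qed
  show thesis
  proof (rule that[of "\<lambda>m. \<psi> (fst (prod_decode m)) (snd (prod_decode m))"])
    show "\<forall>\<mu>\<in>borel_probs. \<forall>\<nu>\<in>borel_probs.
      (\<forall>n. (\<integral>x. \<psi> (fst (prod_decode n)) (snd (prod_decode n)) x \<partial>\<mu>) =
        (\<integral>x. \<psi> (fst (prod_decode n)) (snd (prod_decode n)) x \<partial>\<nu>)) \<longrightarrow> \<mu> = \<nu>"
    proof (intro ballI impI)
      fix \<mu> \<nu> :: "'x measure"
      assume \<mu>: "\<mu> \<in> borel_probs" and \<nu>: "\<nu> \<in> borel_probs"
        and eq: "\<forall>n. (\<integral>x. \<psi> (fst (prod_decode n)) (snd (prod_decode n)) x \<partial>\<mu>) =
          (\<integral>x. \<psi> (fst (prod_decode n)) (snd (prod_decode n)) x \<partial>\<nu>)"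
      interpret \<mu>: prob_space \<mu> using \<mu> by (simp add: borel_probs_def)
      interpret \<nu>: prob_space \<nu> using \<nu> by (simp add: borel_probs_def)
      have eq': "(\<integral>x. \<psi> k n x \<partial>\<mu>) = (\<integral>x. \<psi> k n x \<partial>\<nu>)" for k n
        using eq[rule_format, of "prod_encode (k, n)"] by simp
      have "measure \<mu> (D k) = measure \<nu> (D k)" for k
        using borel_probs_measure_open_limit[OF \<mu> openD[of k] \<psi>] 
            borel_probs_measure_open_limit[OF \<nu> openD[of k] \<psi>]
        by (auto simp: eq' intro: LIMSEQ_unique)
      then show "\<mu> = \<nu>"
      proof (intro measure_eqI_generator_eq[OF Int, of UNIV \<mu> \<nu> "\<lambda>_. UNIV"])
        have "UNIV = D (to_nat ([] :: nat list))" by (simp add: D_def)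
        then show "range (\<lambda>_. UNIV) \<subseteq> range D" by blast
      qed (use \<mu> \<nu> gen in \<open>auto simp: borel_probs_def \<mu>.emeasure_eq_measure \<nu>.emeasure_eq_measure\<close>)
    qed
  qed (use \<psi> in auto)
qed

text \<open>The direct method: a weak limit of a minimizing sequence. It is kept general because it
  serves twice, for a linear functional on the invariant measures and for a concave one on the set
  of its minimizers.\<close>

lemma weakly_tendsto_attains_min:
  fixes S :: "'x::t2_space measure set" and \<Phi> :: "'x measure \<Rightarrow> real"
  assumes comp: "compact (UNIV :: 'x set)" and metr: "metrizable_space (euclidean :: 'x topology)"
    and S: "S \<subseteq> borel_probs" "S \<noteq> {}"
    and closed: "\<And>\<nu> \<mu>. range \<nu> \<subseteq> S \<Longrightarrow> \<mu> \<in> borel_probs \<Longrightarrow> weakly_tendsto \<nu> \<mu> \<Longrightarrow> \<mu> \<in> S"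
    and cont: "\<And>\<nu> \<mu>. range \<nu> \<subseteq> S \<Longrightarrow> \<mu> \<in> S \<Longrightarrow> weakly_tendsto \<nu> \<mu> \<Longrightarrow> (\<lambda>n. \<Phi> (\<nu> n)) \<longlonglongrightarrow> \<Phi> \<mu>"
    and bdd: "bdd_below (\<Phi> ` S)"
  shows "\<exists>\<theta>\<in>S. \<forall>\<mu>\<in>S. \<Phi> \<theta> \<le> \<Phi> \<mu>"
proof -
  define I where "I = Inf (\<Phi> ` S)"
  have I_le: "I \<le> \<Phi> \<mu>" if "\<mu> \<in> S" for \<mu> unfolding I_def using bdd that by (simp add: cInf_lower)
  have "\<exists>\<nu>\<in>S. \<Phi> \<nu> < I + 1 / Suc n" for n
  proof -
    have "\<exists>y\<in>\<Phi> ` S. y < I + 1 / Suc n"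
      unfolding I_def using S(2) by (intro cInf_lessD) auto
    then show ?thesis by blast
  qed
  then obtain \<nu> where \<nu>: "\<And>n. \<nu> n \<in> S" "\<And>n. \<Phi> (\<nu> n) < I + 1 / Suc n" by metis
  obtain r \<mu> where r: "strict_mono (r :: nat \<Rightarrow> nat)" and \<mu>: "\<mu> \<in> borel_probs"
    and lim: "weakly_tendsto (\<nu> \<circ> r) \<mu>"
    by (rule borel_probs_weakly_sequentially_compact[OF comp metr, of \<nu>]) (use \<nu>(1) S(1) in auto)
  have ran: "range (\<nu> \<circ> r) \<subseteq> S" using \<nu>(1) by auto
  have "\<mu> \<in> S" by (rule closed[OF ran \<mu> lim])
  have "(\<lambda>n. I + 1 / Suc n) \<longlonglongrightarrow> I + 0" by (intro tendsto_intros LIMSEQ_Suc[OF lim_1_over_n])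
  then have "((\<lambda>n. I + 1 / Suc n) \<circ> r) \<longlonglongrightarrow> I" using r by (simp add: LIMSEQ_subseq_LIMSEQ)
  moreover have "\<Phi> ((\<nu> \<circ> r) n) \<le> ((\<lambda>n. I + 1 / Suc n) \<circ> r) n" for n
    using \<nu>(2)[of "r n"] by simp
  ultimately have "\<Phi> \<mu> \<le> I"
    using cont[OF ran \<open>\<mu> \<in> S\<close> lim] LIMSEQ_le by blast
  with I_le \<open>\<mu> \<in> S\<close> show ?thesis by (meson order.trans)
qed

section \<open>Invariant and ergodic measures\<close>

text \<open>Extremality is phrased by convex combinations on Borel sets, whereas the extremality
  argument combines integrals; induction over nonnegative measurable functions passes from one to
  the other.\<close>

lemma nn_integral_convex_combination:
  fixes u :: "'x::topological_space \<Rightarrow> ennreal"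
  assumes sets: "sets \<theta> = sets borel" "sets \<mu> = sets borel" "sets \<nu> = sets borel"
    and comb: "\<And>A. A \<in> sets borel \<Longrightarrow> emeasure \<theta> A = a * emeasure \<mu> A + b * emeasure \<nu> A"
    and "u \<in> borel_measurable borel"
  shows "(\<integral>\<^sup>+x. u x \<partial>\<theta>) = a * (\<integral>\<^sup>+x. u x \<partial>\<mu>) + b * (\<integral>\<^sup>+x. u x \<partial>\<nu>)"
  using assms(5)
proof (induction rule: borel_measurable_induct)
  case (cong f g)
  then show ?case by (simp cong: nn_integral_cong)
next
  case (set A)
  then show ?case using sets comb by simp
next
  case (mult u c)
  have m: "u \<in> borel_measurable \<theta>" "u \<in> borel_measurable \<mu>" "u \<in> borel_measurable \<nu>"
    using mult(2) measurable_cong_sets[OF sets(1) refl] measurable_cong_sets[OF sets(2) refl]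
      measurable_cong_sets[OF sets(3) refl] by blast+
  show ?case using mult(4) by (simp add: nn_integral_cmult m distrib_left mult.left_commute)
next
  case (add u v)
  have m: "w \<in> borel_measurable \<theta>" "w \<in> borel_measurable \<mu>" "w \<in> borel_measurable \<nu>"
    if "w \<in> borel_measurable borel" for w :: "'x \<Rightarrow> ennreal"
    using that measurable_cong_sets[OF sets(1) refl] measurable_cong_sets[OF sets(2) refl]
      measurable_cong_sets[OF sets(3) refl] by blast+
  show ?case using add by (simp add: nn_integral_add m distrib_left algebra_simps)
next
  case (seq U)
  have m: "U i \<in> borel_measurable \<theta>" "U i \<in> borel_measurable \<mu>" "U i \<in> borel_measurable \<nu>" for i
    using seq(1) measurable_cong_sets[OF sets(1) refl] measurable_cong_sets[OF sets(2) refl]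
      measurable_cong_sets[OF sets(3) refl] by blast+
  have I: "(\<integral>\<^sup>+x. (SUP i. U i) x \<partial>M) = (SUP i. \<integral>\<^sup>+x. U i x \<partial>M)"
    if "\<And>i. U i \<in> borel_measurable M" for M
    using nn_integral_monotone_convergence_SUP[OF seq(3) that] by (simp add: image_comp)
  have inc: "incseq (\<lambda>i. c * (\<integral>\<^sup>+x. U i x \<partial>M))" for c M
    using seq(3) by (auto simp: incseq_def le_fun_def intro!: mult_left_mono nn_integral_mono)
  show ?case
    unfolding I[OF m(1)] I[OF m(2)] I[OF m(3)] seq.IH SUP_mult_left_ennreal
    by (rule ennreal_SUP_add[OF inc inc])
qed

lemma borel_probs_integral_convex_combination:
  fixes g :: "'x::topological_space \<Rightarrow> real"
  assumes "\<theta> \<in> borel_probs" "\<mu> \<in> borel_probs" "\<nu> \<in> borel_probs" and t: "0 < t" "t < 1"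
    and comb: "\<forall>A\<in>sets borel. measure \<theta> A = (1 - t) * measure \<mu> A + t * measure \<nu> A"
    and g: "g \<in> borel_measurable borel" and B: "\<And>x. \<bar>g x\<bar> \<le> B"
  shows "(\<integral>x. g x \<partial>\<theta>) = (1 - t) * (\<integral>x. g x \<partial>\<mu>) + t * (\<integral>x. g x \<partial>\<nu>)"
proof -
  interpret \<theta>: prob_space \<theta> using assms by (simp add: borel_probs_def)
  interpret \<mu>: prob_space \<mu> using assms by (simp add: borel_probs_def)
  interpret \<nu>: prob_space \<nu> using assms by (simp add: borel_probs_def)
  have sets: "sets \<theta> = sets borel" "sets \<mu> = sets borel" "sets \<nu> = sets borel"
    using assms by (simp_all add: borel_probs_def)
  \<comment> \<open>Shifting by \<open>B\<close> reduces to nonnegative functions. The shift cancels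
    at the end, as all three measures have mass 1 and the weights sum to 1.\<close>
  have nonneg: "0 \<le> g x + B" for x using B[of x] by linarith
  have gB: "(\<lambda>x. g x + B) \<in> borel_measurable borel" using g by simp
  have em: "emeasure \<theta> A = ennreal (1 - t) * emeasure \<mu> A + ennreal t * emeasure \<nu> A"
    if "A \<in> sets borel" for A
    using comb that t unfolding \<theta>.emeasure_eq_measure \<mu>.emeasure_eq_measure \<nu>.emeasure_eq_measure
    by (simp add: ennreal_plus[symmetric] ennreal_mult[symmetric] del: ennreal_plus)
  have shift: "(\<integral>\<^sup>+x. ennreal (g x + B) \<partial>M) = ennreal ((\<integral>x. g x \<partial>M) + B)" "0 \<le> (\<integral>x. g x \<partial>M) + B"
    if M: "M \<in> borel_probs" for M
  proof -
    interpret M: prob_space M using M by (simp add: borel_probs_def)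
    have i: "integrable M g" by (rule borel_probs_integrable[OF M g B])
    have eq: "(\<integral>x. g x + B \<partial>M) = (\<integral>x. g x \<partial>M) + B" using i by (simp add: M.prob_space)
    have "(\<integral>\<^sup>+x. ennreal (g x + B) \<partial>M) = ennreal (\<integral>x. g x + B \<partial>M)"
      using i nonneg by (intro nn_integral_eq_integral) auto
    then show "(\<integral>\<^sup>+x. ennreal (g x + B) \<partial>M) = ennreal ((\<integral>x. g x \<partial>M) + B)" by (simp add: eq)
    have "0 \<le> (\<integral>x. g x + B \<partial>M)" using nonneg by (intro integral_nonneg_AE) auto
    then show "0 \<le> (\<integral>x. g x \<partial>M) + B" by (simp add: eq)
  qed
  note sh = shift[OF assms(1)] shift[OF assms(2)] shift[OF assms(3)]
  have "ennreal ((\<integral>x. g x \<partial>\<theta>) + B) =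
      ennreal (1 - t) * ennreal ((\<integral>x. g x \<partial>\<mu>) + B) + ennreal t * ennreal ((\<integral>x. g x \<partial>\<nu>) + B)"
    using nn_integral_convex_combination[OF sets em, of "\<lambda>x. ennreal (g x + B)"] gB by (simp add: sh)
  also have "\<dots> = ennreal ((1 - t) * ((\<integral>x. g x \<partial>\<mu>) + B) + t * ((\<integral>x. g x \<partial>\<nu>) + B))"
    using t sh by (simp add: ennreal_plus[symmetric] ennreal_mult[symmetric] del: ennreal_plus)
  finally have "(\<integral>x. g x \<partial>\<theta>) + B = (1 - t) * ((\<integral>x. g x \<partial>\<mu>) + B) + t * ((\<integral>x. g x \<partial>\<nu>) + B)"
    using t sh by (subst (asm) ennreal_inj) auto
  then show ?thesis by (simp add: algebra_simps)
qed

locale compact_metrizable_action =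
  fixes G :: "('g, 'm) monoid_scheme" and T :: "'g \<Rightarrow> 'x::t2_space \<Rightarrow> 'x"
  assumes compact_space: "compact (UNIV :: 'x set)"
    and metrizable: "metrizable_space (euclidean :: 'x topology)"
    and group: "group G"
    and action: "action_by_homeos G T"
begin

lemma continuous_T: "a \<in> carrier G \<Longrightarrow> continuous_on UNIV (T a)"
  using action homeomorphic_imp_continuous_map unfolding action_by_homeos_def by fastforce

lemma continuous_comp_T: "a \<in> carrier G \<Longrightarrow> continuous_on UNIV f \<Longrightarrow> continuous_on UNIV (\<lambda>x. f (T a x))"
  using continuous_on_compose2[of UNIV f UNIV "T a"] continuous_T by auto

lemma invariant_borel_probs: "\<mu> \<in> invariant_measures G T \<Longrightarrow> \<mu> \<in> borel_probs"
  by (simp add: invariant_measures_def borel_probs_def)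

lemma integral_comp_T:
  fixes f :: "'x \<Rightarrow> real"
  assumes "\<mu> \<in> invariant_measures G T" "a \<in> carrier G" "continuous_on UNIV f"
  shows "(\<integral>x. f (T a x) \<partial>\<mu>) = (\<integral>x. f x \<partial>\<mu>)"
proof -
  have "T a \<in> measurable \<mu> borel"
    using borel_probs_continuous_measurable[OF invariant_borel_probs continuous_T] assms by blast
  then have "(\<integral>x. f x \<partial>distr \<mu> borel (T a)) = (\<integral>x. f (T a x) \<partial>\<mu>)"
    by (rule integral_distr) (rule borel_measurable_continuous_onI[OF assms(3)])
  moreover have "distr \<mu> borel (T a) = \<mu>" using assms by (simp add: invariant_measures_def)
  ultimately show ?thesis by simp
qed

text \<open>The separating sequence cannot distinguish the measure from its pushforward. In this
  form invariance passes to weak limits.\<close>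

lemma invariant_measuresI:
  assumes \<mu>: "\<mu> \<in> borel_probs"
    and inv: "\<forall>a\<in>carrier G. \<forall>f :: 'x \<Rightarrow> real. continuous_on UNIV f \<longrightarrow> (\<integral>x. f (T a x) \<partial>\<mu>) = (\<integral>x. f x \<partial>\<mu>)"
  shows "\<mu> \<in> invariant_measures G T"
proof -
  obtain \<phi> :: "nat \<Rightarrow> 'x \<Rightarrow> real" where cont: "\<forall>n. continuous_on UNIV (\<phi> n)"
    and sep: "\<forall>\<mu>\<in>borel_probs. \<forall>\<nu>\<in>borel_probs. (\<forall>n. (\<integral>x. \<phi> n x \<partial>\<mu>) = (\<integral>x. \<phi> n x \<partial>\<nu>)) \<longrightarrow> \<mu> = \<nu>"
    by (rule compact_metrizable_separating_sequence[OF compact_space metrizable])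
  note \<phi> = cont[rule_format]
  have "distr \<mu> borel (T a) = \<mu>" if a: "a \<in> carrier G" for a
  proof (rule sep[rule_format, OF _ \<mu>])
    have m: "T a \<in> measurable \<mu> borel"
      by (rule borel_probs_continuous_measurable[OF \<mu> continuous_T[OF a]])
    show "distr \<mu> borel (T a) \<in> borel_probs"
      using prob_space.prob_space_distr[OF _ m] \<mu> by (simp add: borel_probs_def)
    show "(\<integral>x. \<phi> n x \<partial>distr \<mu> borel (T a)) = (\<integral>x. \<phi> n x \<partial>\<mu>)" for n
      using integral_distr[OF m borel_measurable_continuous_onI[OF \<phi>]] inv a \<phi> by simp
  qed
  then show ?thesis using \<mu> by (simp add: invariant_measures_def borel_probs_def)
qed

lemma invariant_measures_weakly_closed:
  assumes "range \<nu> \<subseteq> invariant_measures G T" and \<mu>: "\<mu> \<in> borel_probs" and lim: "weakly_tendsto \<nu> \<mu>"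
  shows "\<mu> \<in> invariant_measures G T"
proof (rule invariant_measuresI[OF \<mu>], intro ballI allI impI)
  fix a and f :: "'x \<Rightarrow> real" assume a: "a \<in> carrier G" and f: "continuous_on UNIV f"
  have "(\<lambda>n. \<integral>x. f (T a x) \<partial>\<nu> n) \<longlonglongrightarrow> (\<integral>x. f (T a x) \<partial>\<mu>)"
    by (rule weakly_tendstoD[OF lim continuous_comp_T[OF a f]])
  moreover have "(\<integral>x. f (T a x) \<partial>\<nu> n) = (\<integral>x. f x \<partial>\<nu> n)" for n
    by (rule integral_comp_T) (use assms(1) a f in auto)
  ultimately show "(\<integral>x. f (T a x) \<partial>\<mu>) = (\<integral>x. f x \<partial>\<mu>)"
    using weakly_tendstoD[OF lim f] LIMSEQ_unique by simp
qed

text \<open>Among the minimizers of \<open>\<integral>f\<close>, a maximizer of the strictly convex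
  functional \<open>\<mu> \<mapsto> \<Sum>n. 2\<^sup>-\<^sup>n (\<integral>\<phi>\<^sub>n \<partial>\<mu>)\<^sup>2\<close>, with \<open>\<phi>\<close> separating measures, is an extreme point.\<close>

lemma ergodic_minimizer:
  fixes f :: "'x \<Rightarrow> real"
  assumes f: "continuous_on UNIV f" and ne: "invariant_measures G T \<noteq> {}"
  obtains \<theta> where "\<theta> \<in> ergodic_measures G T"
    and "\<And>\<mu>. \<mu> \<in> invariant_measures G T \<Longrightarrow> (\<integral>x. f x \<partial>\<theta>) \<le> (\<integral>x. f x \<partial>\<mu>)"
proof -
  let ?M = "invariant_measures G T"
  obtain B where B: "B \<ge> 0" "\<And>x. \<bar>f x\<bar> \<le> B" using compact_continuous_bounded[OF compact_space f] by blast
  have f_meas: "f \<in> borel_measurable borel" by (rule borel_measurable_continuous_onI[OF f])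
  have "\<exists>\<theta>\<in>?M. \<forall>\<mu>\<in>?M. (\<integral>x. f x \<partial>\<theta>) \<le> (\<integral>x. f x \<partial>\<mu>)"
  proof (rule weakly_tendsto_attains_min[OF compact_space metrizable _ ne])
    show "?M \<subseteq> borel_probs" using invariant_borel_probs by blast
    show "bdd_below ((\<lambda>\<mu>. \<integral>x. f x \<partial>\<mu>) ` ?M)"
    proof (rule bdd_belowI2)
      show "- B \<le> (\<integral>x. f x \<partial>\<mu>)" if "\<mu> \<in> ?M" for \<mu>
        using borel_probs_integral_bound[OF invariant_borel_probs[OF that] f_meas B(2)] by linarith
    qed
    show "\<mu> \<in> ?M" if "range \<nu> \<subseteq> ?M" "\<mu> \<in> borel_probs" "weakly_tendsto \<nu> \<mu>" for \<nu> \<mu>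
      by (rule invariant_measures_weakly_closed[OF that])
    show "(\<lambda>n. \<integral>x. f x \<partial>\<nu> n) \<longlonglongrightarrow> (\<integral>x. f x \<partial>\<mu>)" if "weakly_tendsto \<nu> \<mu>" for \<nu> \<mu>
      by (rule weakly_tendstoD[OF that f])
  qed
  then obtain \<theta>0 where \<theta>0: "\<theta>0 \<in> ?M" "\<And>\<mu>. \<mu> \<in> ?M \<Longrightarrow> (\<integral>x. f x \<partial>\<theta>0) \<le> (\<integral>x. f x \<partial>\<mu>)" by blast
  define S where "S = {\<mu>\<in>?M. (\<integral>x. f x \<partial>\<mu>) = (\<integral>x. f x \<partial>\<theta>0)}"
  obtain \<phi> :: "nat \<Rightarrow> 'x \<Rightarrow> real" where cont: "\<forall>n. continuous_on UNIV (\<phi> n)"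
    and ran: "\<forall>n x. 0 \<le> \<phi> n x \<and> \<phi> n x \<le> 1"
    and sep: "\<forall>\<mu>\<in>borel_probs. \<forall>\<nu>\<in>borel_probs. (\<forall>n. (\<integral>x. \<phi> n x \<partial>\<mu>) = (\<integral>x. \<phi> n x \<partial>\<nu>)) \<longrightarrow> \<mu> = \<nu>"
    by (rule compact_metrizable_separating_sequence[OF compact_space metrizable])
  note \<phi> = cont[rule_format]
  have \<phi>_meas: "\<phi> n \<in> borel_measurable borel" for n by (rule borel_measurable_continuous_onI[OF \<phi>])
  have \<phi>_abs: "\<bar>\<phi> n x\<bar> \<le> 1" for n x using ran by simp
  define P where "P \<mu> = (\<Sum>n. (1/2)^n * (\<integral>x. \<phi> n x \<partial>\<mu>)\<^sup>2)" for \<mu>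
  have half: "summable (\<lambda>n. (1/2)^n :: real)" by (rule summable_geometric) simp
  have bound: "norm ((1/2)^n * (\<integral>x. \<phi> n x \<partial>\<mu>)\<^sup>2) \<le> (1/2)^n" if "\<mu> \<in> borel_probs" for n \<mu>
    using borel_probs_integral_bound[OF that \<phi>_meas \<phi>_abs, of n]
    by (simp add: abs_square_le_1)
  have summ: "summable (\<lambda>n. (1/2)^n * (\<integral>x. \<phi> n x \<partial>\<mu>)\<^sup>2)" if "\<mu> \<in> borel_probs" for \<mu>
    by (rule summable_comparison_test'[OF half, of 0]) (rule bound[OF that])
  have S_probs: "S \<subseteq> borel_probs" unfolding S_def using invariant_borel_probs by blast
  have "\<exists>\<theta>\<in>S. \<forall>\<mu>\<in>S. - P \<theta> \<le> - P \<mu>"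
  proof (rule weakly_tendsto_attains_min[OF compact_space metrizable S_probs])
    show "S \<noteq> {}" using \<theta>0(1) by (auto simp: S_def)
    show "\<mu> \<in> S" if "range \<nu> \<subseteq> S" "\<mu> \<in> borel_probs" "weakly_tendsto \<nu> \<mu>" for \<nu> \<mu>
    proof -
      have "\<mu> \<in> ?M" using that by (intro invariant_measures_weakly_closed[of \<nu>]) (auto simp: S_def)
      moreover have "(\<lambda>n. \<integral>x. f x \<partial>\<nu> n) = (\<lambda>n. \<integral>x. f x \<partial>\<theta>0)" using that(1) by (auto simp: S_def)
      then have "(\<integral>x. f x \<partial>\<mu>) = (\<integral>x. f x \<partial>\<theta>0)"
        using weakly_tendstoD[OF that(3) f] LIMSEQ_unique[OF _ tendsto_const] by metis
      ultimately show ?thesis by (simp add: S_def)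
    qed
    show "(\<lambda>n. - P (\<nu> n)) \<longlonglongrightarrow> - P \<mu>" if ran: "range \<nu> \<subseteq> S" and lim: "weakly_tendsto \<nu> \<mu>" for \<nu> \<mu>
    proof -
      have \<nu>: "\<nu> k \<in> borel_probs" for k using ran S_probs by blast
      have "(\<lambda>k. \<Sum>n. (1/2)^n * (\<integral>x. \<phi> n x \<partial>\<nu> k)\<^sup>2) \<longlonglongrightarrow> (\<Sum>n. (1/2)^n * (\<integral>x. \<phi> n x \<partial>\<mu>)\<^sup>2)"
      \<comment> \<open>Dominated convergence for series: every term is weakly continuous and
        bounded by (1/2)^n uniformly in the measure.\<close>
      proof (rule tannerys_theorem[THEN conjunct2, THEN conjunct2])
        show "((\<lambda>k. (1/2)^n * (\<integral>x. \<phi> n x \<partial>\<nu> k)\<^sup>2) \<longlongrightarrow> (1/2)^n * (\<integral>x. \<phi> n x \<partial>\<mu>)\<^sup>2) sequentially" for n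
          by (intro tendsto_intros weakly_tendstoD[OF lim] \<phi>)
        show "\<forall>\<^sub>F (n, k) in at_top \<times>\<^sub>F sequentially. norm ((1/2)^n * (\<integral>x. \<phi> n x \<partial>\<nu> k)\<^sup>2) \<le> (1/2)^n"
          using bound[OF \<nu>] by (intro always_eventually) auto
      qed (use half in auto)
      then show ?thesis unfolding P_def by (rule tendsto_minus)
    qed
    show "bdd_below ((\<lambda>\<mu>. - P \<mu>) ` S)"
    proof (rule bdd_belowI2)
      fix \<mu> assume "\<mu> \<in> S"
      then have \<mu>: "\<mu> \<in> borel_probs" using S_probs by blast
      have "norm (P \<mu>) \<le> (\<Sum>n. (1/2)^n)" unfolding P_def by (rule norm_suminf_le[OF bound[OF \<mu>] half])
      then show "- (\<Sum>n. (1/2)^n) \<le> - P \<mu>" by simp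
    qed
  qed
  then obtain \<theta> where \<theta>: "\<theta> \<in> S" "\<And>\<mu>. \<mu> \<in> S \<Longrightarrow> P \<mu> \<le> P \<theta>" by auto
  have "\<theta> \<in> ergodic_measures G T"
    unfolding ergodic_measures_def
  proof (intro CollectI conjI ballI allI impI)
    show "\<theta> \<in> ?M" using \<theta>(1) by (simp add: S_def)
    fix \<mu> \<nu> and t :: real
    assume \<mu>: "\<mu> \<in> ?M" and \<nu>: "\<nu> \<in> ?M"
      and t: "0 < t \<and> t < 1 \<and> (\<forall>A\<in>sets borel. measure \<theta> A = (1 - t) * measure \<mu> A + t * measure \<nu> A)"
    have pr: "\<theta> \<in> borel_probs" "\<mu> \<in> borel_probs" "\<nu> \<in> borel_probs"
      using \<theta>(1) S_probs \<mu> \<nu> invariant_borel_probs by auto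
    have comb: "(\<integral>x. g x \<partial>\<theta>) = (1 - t) * (\<integral>x. g x \<partial>\<mu>) + t * (\<integral>x. g x \<partial>\<nu>)"
      if "g \<in> borel_measurable borel" "\<And>x. \<bar>g x\<bar> \<le> C" for g :: "'x \<Rightarrow> real" and C
      using borel_probs_integral_convex_combination[OF pr, of t g C] t that by blast
    let ?m = "\<integral>x. f x \<partial>\<theta>0"
    \<comment> \<open>The minimizers form a face: both excesses over the minimum are nonnegative and
      their weighted sum is 0, so both measures are minimizers.\<close>
    have "(1 - t) * ((\<integral>x. f x \<partial>\<mu>) - ?m) + t * ((\<integral>x. f x \<partial>\<nu>) - ?m) = 0"
      using comb[OF f_meas B(2)] \<theta>(1) by (simp add: S_def algebra_simps)
    moreover have "(1 - t) * ((\<integral>x. f x \<partial>\<mu>) - ?m) \<ge> 0" "t * ((\<integral>x. f x \<partial>\<nu>) - ?m) \<ge> 0"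
      using \<theta>0(2)[OF \<mu>] \<theta>0(2)[OF \<nu>] t by simp_all
    ultimately have "(1 - t) * ((\<integral>x. f x \<partial>\<mu>) - ?m) = 0" "t * ((\<integral>x. f x \<partial>\<nu>) - ?m) = 0" by linarith+
    then have "\<mu> \<in> S" "\<nu> \<in> S" using t \<mu> \<nu> by (auto simp: S_def)
    define a where "a n = (\<integral>x. \<phi> n x \<partial>\<mu>)" for n
    define b where "b n = (\<integral>x. \<phi> n x \<partial>\<nu>)" for n
    define w where "w n = (1/2)^n * (a n - b n)\<^sup>2" for n
    have \<theta>n: "(\<integral>x. \<phi> n x \<partial>\<theta>) = (1 - t) * a n + t * b n" for n
      unfolding a_def b_def by (rule comb[OF \<phi>_meas \<phi>_abs])
    \<comment> \<open>The defect of convexity of the square is t(1-t)(a-b)^2. Maximality of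
      \<open>P \<theta>\<close> makes the summed defect nonpositive, which forces
      \<open>a n = b n\<close> for every \<open>n\<close>.\<close>
    have split: "t * (1 - t) * w n = (1 - t) * ((1/2)^n * (a n)\<^sup>2) + t * ((1/2)^n * (b n)\<^sup>2)
        - (1/2)^n * ((1 - t) * a n + t * b n)\<^sup>2" for n
      unfolding w_def by (simp add: power2_eq_square algebra_simps)
    have sums: "(\<lambda>n. t * (1 - t) * w n) sums ((1 - t) * P \<mu> + t * P \<nu> - P \<theta>)"
      unfolding split P_def a_def[symmetric] b_def[symmetric] \<theta>n
      using summ[OF pr(1)] summ[OF pr(2)] summ[OF pr(3)]
      unfolding a_def[symmetric] b_def[symmetric] \<theta>n
      by (intro sums_diff sums_add sums_mult summable_sums)
    have nonneg: "0 \<le> t * (1 - t) * w n" for n using t by (simp add: w_def)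
    have "(1 - t) * P \<mu> + t * P \<nu> \<le> (1 - t) * P \<theta> + t * P \<theta>"
      using t \<theta>(2) \<open>\<mu> \<in> S\<close> \<open>\<nu> \<in> S\<close> by (intro add_mono mult_left_mono) auto
    then have "(\<Sum>n. t * (1 - t) * w n) \<le> 0" using sums_unique[OF sums] by (simp add: algebra_simps)
    then have "(\<Sum>n. t * (1 - t) * w n) = 0"
      using suminf_nonneg[OF sums_summable[OF sums] nonneg] by linarith
    then have "t * (1 - t) * w n = 0" for n
      using suminf_eq_zero_iff[OF sums_summable[OF sums] nonneg] by blast
    then have "a n = b n" for n using t by (simp add: w_def)
    then show "\<mu> = \<nu>" using sep pr(2,3) by (simp add: a_def b_def)
  qed
  moreover have "(\<integral>x. f x \<partial>\<theta>) \<le> (\<integral>x. f x \<partial>\<mu>)" if "\<mu> \<in> ?M" for \<mu>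
    using \<theta>(1) \<theta>0(2)[OF that] by (simp add: S_def)
  ultimately show thesis by (rule that)
qed

end

section \<open>Averages along a Foelner sequence\<close>

lemma Avg_uminus: "Avg T A (\<lambda>x. - f x) x = - Avg T A f x"
  by (simp add: Avg_def sum_negf)

lemma Avg_bounded:
  assumes "\<And>x. \<bar>f x\<bar> \<le> B" and "finite A" "A \<noteq> {}"
  shows "\<bar>Avg T A f x\<bar> \<le> B"
proof -
  have "\<bar>\<Sum>g\<in>A. f (T g x)\<bar> \<le> (\<Sum>g\<in>A. B)"
    using assms(1) by (intro order.trans[OF sum_abs] sum_mono)
  then show ?thesis using assms(2,3) by (simp add: Avg_def card_gt_0_iff divide_le_eq mult.commute)
qed

lemma abs_sum_diff_le_sym_diff:
  fixes u :: "'a \<Rightarrow> real"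
  assumes "finite A" "finite B" and "\<And>x. \<bar>u x\<bar> \<le> C"
  shows "\<bar>sum u A - sum u B\<bar> \<le> C * card (sym_diff A B)"
proof -
  have "sum u A - sum u B = sum u (A - B) - sum u (B - A)"
    using sum_diff1'[of A] sum.Int_Diff[OF assms(1), of u B] sum.Int_Diff[OF assms(2), of u A]
    by (simp add: Int_commute)
  also have "\<bar>\<dots>\<bar> \<le> (\<Sum>x\<in>A - B. \<bar>u x\<bar>) + (\<Sum>x\<in>B - A. \<bar>u x\<bar>)"
    using sum_abs[of u "A - B"] sum_abs[of u "B - A"] by linarith
  also have "\<dots> = (\<Sum>x\<in>sym_diff A B. \<bar>u x\<bar>)"
    using assms by (intro sum.union_disjoint[symmetric]) auto
  also have "\<dots> \<le> (\<Sum>x\<in>sym_diff A B. C)" by (intro sum_mono assms)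
  finally show ?thesis by (simp add: mult.commute)
qed

locale folner_action = compact_metrizable_action G T
  for G :: "('g, 'm) monoid_scheme" and T :: "'g \<Rightarrow> 'x::t2_space \<Rightarrow> 'x" +
  fixes F :: "nat \<Rightarrow> 'g set"
  assumes folner: "folner_sequence G F"
begin

lemma F: "finite (F k)" "F k \<noteq> {}" "F k \<subseteq> carrier G" "real (card (F k)) > 0"
  using folner by (auto simp: folner_sequence_def card_gt_0_iff)

text \<open>Because T_a T_g = T_(ag), averaging f o T_a over \<open>F k\<close> is averaging
  \<open>f\<close> over the left translate of \<open>F k\<close>. The two sums differ only on the
  symmetric difference, which is what the Foelner condition controls.\<close>

lemma Avg_translate_le:
  fixes f :: "'x \<Rightarrow> real"
  assumes a: "a \<in> carrier G" and C: "\<And>x. \<bar>f x\<bar> \<le> C"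
  shows "\<bar>Avg T (F k) (\<lambda>x. f (T a x)) x - Avg T (F k) f x\<bar> \<le>
           C * (real (card (sym_diff (F k) (a <#\<^bsub>G\<^esub> F k))) / real (card (F k)))"
proof -
  have comp: "T a (T g x) = T (a \<otimes>\<^bsub>G\<^esub> g) x" if "g \<in> F k" for g
    using action a F(3) that unfolding action_by_homeos_def by (metis comp_apply subsetD)
  have coset: "a <#\<^bsub>G\<^esub> F k = (\<lambda>g. a \<otimes>\<^bsub>G\<^esub> g) ` F k" by (auto simp: l_coset_def)
  have inj: "inj_on (\<lambda>g. a \<otimes>\<^bsub>G\<^esub> g) (F k)"
    using inj_on_subset[OF group.inj_on_cmult[OF group a] F(3)] .
  have "(\<Sum>g\<in>F k. f (T a (T g x))) = (\<Sum>g\<in>a <#\<^bsub>G\<^esub> F k. f (T g x))"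
    unfolding coset sum.reindex[OF inj] by (simp add: comp)
  then have "\<bar>(\<Sum>g\<in>F k. f (T a (T g x))) - (\<Sum>g\<in>F k. f (T g x))\<bar> \<le>
      C * card (sym_diff (F k) (a <#\<^bsub>G\<^esub> F k))"
    using abs_sum_diff_le_sym_diff[of "F k" "a <#\<^bsub>G\<^esub> F k" "\<lambda>g. f (T g x)" C] F(1) C
    by (simp add: coset abs_minus_commute)
  then show ?thesis
    using F(4)[of k] by (simp add: Avg_def diff_divide_distrib[symmetric] abs_divide divide_right_mono)
qed

text \<open>The mean of the point masses at T_g x. As a pushforward of the uniform distribution on
  \<open>F k\<close> it counts coinciding orbit points with multiplicity.\<close>

definition empirical_measure :: "nat \<Rightarrow> 'x \<Rightarrow> 'x measure" where
  "empirical_measure k x = distr (measure_pmf (pmf_of_set (F k))) borel (\<lambda>g. T g x)"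

lemma empirical_borel_probs: "empirical_measure k x \<in> borel_probs"
  unfolding empirical_measure_def borel_probs_def
  by (auto intro!: prob_space.prob_space_distr measure_pmf.prob_space_axioms)

lemma integral_empirical:
  fixes f :: "'x \<Rightarrow> real"
  assumes "continuous_on UNIV f"
  shows "(\<integral>y. f y \<partial>empirical_measure k x) = Avg T (F k) f x"
  unfolding empirical_measure_def Avg_def
  using F(1,2) by (subst integral_distr)
    (auto simp: integral_pmf_of_set borel_measurable_continuous_onI[OF assms])

text \<open>The Krylov-Bogolyubov construction. The base points \<open>x n\<close> are arbitrary and
  may change with \<open>n\<close>, since near-minimizers of the averages do; one measure serves all
  continuous \<open>f\<close> at once.\<close>

lemma exists_invariant_limit:
  fixes k :: "nat \<Rightarrow> nat"
  assumes k: "strict_mono k"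
  shows "\<exists>r \<mu>. strict_mono (r :: nat \<Rightarrow> nat) \<and> \<mu> \<in> invariant_measures G T \<and>
    (\<forall>f :: 'x \<Rightarrow> real. continuous_on UNIV f \<longrightarrow>
       (\<lambda>n. Avg T (F (k (r n))) f (x (r n))) \<longlonglongrightarrow> (\<integral>y. f y \<partial>\<mu>))"
proof -
  define \<nu> where "\<nu> n = empirical_measure (k n) (x n)" for n
  obtain r \<mu> where r: "strict_mono (r :: nat \<Rightarrow> nat)" and \<mu>: "\<mu> \<in> borel_probs"
    and lim: "weakly_tendsto (\<nu> \<circ> r) \<mu>"
    by (rule borel_probs_weakly_sequentially_compact[OF compact_space metrizable, of \<nu>])
       (auto simp: \<nu>_def empirical_borel_probs)
  have Avg_lim: "(\<lambda>n. Avg T (F (k (r n))) f (x (r n))) \<longlonglongrightarrow> (\<integral>y. f y \<partial>\<mu>)"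
    if "continuous_on UNIV f" for f :: "'x \<Rightarrow> real"
    using weakly_tendstoD[OF lim that] by (simp add: \<nu>_def integral_empirical[OF that])
  have "\<mu> \<in> invariant_measures G T"
  proof (rule invariant_measuresI[OF \<mu>], intro ballI allI impI)
    fix a and f :: "'x \<Rightarrow> real" assume a: "a \<in> carrier G" and f: "continuous_on UNIV f"
    obtain C where C: "C \<ge> 0" "\<And>x. \<bar>f x\<bar> \<le> C" using compact_continuous_bounded[OF compact_space f] by blast
    let ?q = "\<lambda>k. C * (real (card (sym_diff (F k) (a <#\<^bsub>G\<^esub> F k))) / real (card (F k)))"
    have "?q \<longlonglongrightarrow> C * 0"
      using folner a by (intro tendsto_intros) (simp add: folner_sequence_def)
    then have "(?q \<circ> (k \<circ> r)) \<longlonglongrightarrow> 0"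
      using strict_mono_o[OF k r] by (intro LIMSEQ_subseq_LIMSEQ) simp
    then have "(\<lambda>n. Avg T (F (k (r n))) (\<lambda>x. f (T a x)) (x (r n)) - Avg T (F (k (r n))) f (x (r n))) \<longlonglongrightarrow> 0"
      by (rule Lim_null_comparison[rotated]) (use Avg_translate_le[where f=f, OF a C(2)] in \<open>simp add: comp_def\<close>)
    moreover have "(\<lambda>n. Avg T (F (k (r n))) (\<lambda>x. f (T a x)) (x (r n)) - Avg T (F (k (r n))) f (x (r n)))
        \<longlonglongrightarrow> (\<integral>y. f (T a y) \<partial>\<mu>) - (\<integral>y. f y \<partial>\<mu>)"
      by (intro tendsto_diff Avg_lim f continuous_comp_T[OF a])
    ultimately show "(\<integral>y. f (T a y) \<partial>\<mu>) = (\<integral>y. f y \<partial>\<mu>)" using LIMSEQ_unique by fastforce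
  qed
  then show ?thesis using r Avg_lim by blast
qed

lemma invariant_measures_nonempty: "invariant_measures G T \<noteq> {}"
  using exists_invariant_limit[OF strict_mono_id] by blast

lemma continuous_Avg:
  fixes f :: "'x \<Rightarrow> real"
  assumes "continuous_on UNIV f"
  shows "continuous_on UNIV (Avg T (F k) f)"
  unfolding Avg_def using F(3,4) assms by (intro continuous_intros continuous_comp_T) auto

lemma integral_Avg:
  fixes f :: "'x \<Rightarrow> real"
  assumes \<mu>: "\<mu> \<in> invariant_measures G T" and f: "continuous_on UNIV f"
  shows "(\<integral>x. Avg T (F k) f x \<partial>\<mu>) = (\<integral>x. f x \<partial>\<mu>)"
proof -
  obtain C where C: "C \<ge> 0" "\<And>x. \<bar>f x\<bar> \<le> C" using compact_continuous_bounded[OF compact_space f] by blast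
  have i: "integrable \<mu> (\<lambda>x. f (T g x))" if "g \<in> F k" for g
    using F(3) that C(2)
    by (intro borel_probs_integrable[OF invariant_borel_probs[OF \<mu>], where B=C]
        borel_measurable_continuous_onI continuous_comp_T f) auto
  have "(\<integral>x. Avg T (F k) f x \<partial>\<mu>) = (\<Sum>g\<in>F k. \<integral>x. f (T g x) \<partial>\<mu>) / real (card (F k))"
    unfolding Avg_def by (simp add: i)
  also have "(\<Sum>g\<in>F k. \<integral>x. f (T g x) \<partial>\<mu>) = (\<Sum>g\<in>F k. \<integral>x. f x \<partial>\<mu>)"
    using F(3) by (intro sum.cong refl integral_comp_T[OF \<mu> _ f]) auto
  finally show ?thesis using F(4)[of k] by simp
qed

section \<open>Comparison of the lower values\<close>

lemma inf_Avg_le_a_lower: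
  assumes f: "continuous_on UNIV f"
  shows "inf_Avg T F f k \<le> a_lower G T f"
  unfolding a_lower_def
proof (rule INF_greatest)
  fix \<mu> assume \<mu>: "\<mu> \<in> invariant_measures G T"
  interpret prob_space \<mu> using \<mu> by (simp add: invariant_measures_def)
  obtain C where C: "C \<ge> 0" "\<And>x. \<bar>f x\<bar> \<le> C" using compact_continuous_bounded[OF compact_space f] by blast
  have i: "integrable \<mu> (Avg T (F k) f)"
    by (rule borel_probs_integrable[OF invariant_borel_probs[OF \<mu>] borel_measurable_continuous_onI[OF continuous_Avg[OF f]]])
       (rule Avg_bounded[OF C(2) F(1,2)])
  show "inf_Avg T F f k \<le> ereal (\<integral>x. f x \<partial>\<mu>)"
  proof (rule ccontr)
    assume "\<not> ?thesis"
    then obtain c where c: "ereal (\<integral>x. f x \<partial>\<mu>) < ereal c" "ereal c < inf_Avg T F f k"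
      using ereal_dense2 by (metis not_le)
    have "c \<le> Avg T (F k) f x" for x
      using less_INF_D[OF c(2)[unfolded inf_Avg_def], of x] by simp
    then have "c \<le> (\<integral>x. Avg T (F k) f x \<partial>\<mu>)" by (intro integral_ge_const i AE_I2)
    then show False using c(1) by (simp add: integral_Avg[OF \<mu> f])
  qed
qed

text \<open>If infinitely many infima were below some \<open>c\<close> less than
  \<open>a_lower\<close>, points witnessing this would have empirical measures accumulating at an
  invariant measure with integral at most \<open>c\<close>.\<close>

lemma a_lower_le_liminf_inf_Avg:
  assumes f: "continuous_on UNIV f"
  shows "a_lower G T f \<le> liminf (inf_Avg T F f)"
proof (rule ccontr)
  assume "\<not> ?thesis"
  then obtain c where c: "liminf (inf_Avg T F f) < ereal c" "ereal c < a_lower G T f"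
    using ereal_dense2 by (metis not_le)
  have freq: "\<exists>\<^sub>F k in sequentially. inf_Avg T F f k < ereal c"
  proof (rule ccontr)
    assume "\<not> ?thesis"
    then have "\<forall>\<^sub>F k in sequentially. ereal c \<le> inf_Avg T F f k"
      by (simp add: not_frequently not_less)
    then have "ereal c \<le> liminf (inf_Avg T F f)" by (rule Liminf_bounded)
    then show False using c(1) by simp
  qed
  then have inf: "infinite {k. inf_Avg T F f k < ereal c}"
    by (simp add: frequently_cofinite flip: cofinite_eq_sequentially)
  define k where "k = enumerate {k. inf_Avg T F f k < ereal c}"
  have k: "strict_mono k" "\<And>n. inf_Avg T F f (k n) < ereal c"
    unfolding k_def using strict_mono_enumerate[OF inf] enumerate_in_set[OF inf] by auto
  have "\<exists>x. Avg T (F (k n)) f x < c" for n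
    using k(2)[of n] unfolding inf_Avg_def INF_less_iff by auto
  then obtain x where x: "\<And>n. Avg T (F (k n)) f (x n) < c" by metis
  obtain r \<mu> where \<mu>: "\<mu> \<in> invariant_measures G T"
    and lim: "(\<lambda>n. Avg T (F (k (r n))) f (x (r n))) \<longlonglongrightarrow> (\<integral>y. f y \<partial>\<mu>)"
    using exists_invariant_limit[OF k(1), of x] f by blast
  have "(\<integral>y. f y \<partial>\<mu>) \<le> c"
    using x by (intro LIMSEQ_le_const2[OF lim] exI[of _ 0] allI impI less_imp_le)
  moreover have "a_lower G T f \<le> ereal (\<integral>y. f y \<partial>\<mu>)" unfolding a_lower_def by (rule INF_lower[OF \<mu>])
  ultimately show False using c(2) by (metis ereal_less_eq(3) not_le order.trans)
qed

lemma inf_Avg_tendsto: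
  assumes f: "continuous_on UNIV f"
  shows "inf_Avg T F f \<longlonglongrightarrow> a_lower G T f"
proof -
  have "limsup (inf_Avg T F f) \<le> a_lower G T f"
    by (intro Limsup_bounded always_eventually allI inf_Avg_le_a_lower f)
  then show ?thesis
    using a_lower_le_liminf_inf_Avg[OF f] Liminf_le_Limsup[of sequentially "inf_Avg T F f"]
    by (subst tendsto_iff_Liminf_eq_Limsup) (auto intro: order.antisym order.trans)
qed

lemma c_lower_le_a_lower:
  assumes f: "continuous_on UNIV f"
  shows "c_lower T F f \<le> a_lower G T f"
  unfolding a_lower_def
proof (rule INF_greatest)
  fix \<mu> assume \<mu>: "\<mu> \<in> invariant_measures G T"
  interpret prob_space \<mu> using \<mu> by (simp add: invariant_measures_def)
  obtain C where C: "C \<ge> 0" "\<And>x. \<bar>f x\<bar> \<le> C" using compact_continuous_bounded[OF compact_space f] by blast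
  have Avg_C: "\<bar>Avg T (F k) f x\<bar> \<le> C" for k x by (rule Avg_bounded[OF C(2) F(1,2)])
  have m: "Avg T (F k) f \<in> borel_measurable \<mu>" for k
    by (rule borel_probs_continuous_measurable[OF invariant_borel_probs[OF \<mu>] continuous_Avg[OF f]])
  have i: "integrable \<mu> (Avg T (F k) f)" for k
    by (rule integrable_const_bound[where B=C]) (use Avg_C m in auto)
  show "c_lower T F f \<le> ereal (\<integral>x. f x \<partial>\<mu>)"
  proof (rule ccontr)
    assume "\<not> ?thesis"
    then obtain c where c: "ereal (\<integral>x. f x \<partial>\<mu>) < ereal c" "ereal c < c_lower T F f"
      using ereal_dense2 by (metis not_le)
    have ev: "\<forall>\<^sub>F k in sequentially. c < Avg T (F k) f x" for x
    proof -
      have "ereal c < liminf (\<lambda>k. ereal (Avg T (F k) f x))"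
        using less_INF_D[OF c(2)[unfolded c_lower_def]] by simp
      then have "\<forall>\<^sub>F k in sequentially. ereal c < ereal (Avg T (F k) f x)"
        using le_Liminf_iff[THEN iffD1, OF order.refl] by blast
      then show ?thesis by simp
    qed
    \<comment> \<open>Fatou's lemma requires nonnegative functions, hence the shift by the uniform
      bound \<open>C\<close>. By invariance the shifted averages have the same integral for all
      \<open>k\<close>, so the lower limit on the right is that of a constant sequence.\<close>
    have nonneg: "0 \<le> Avg T (F k) f x + C" for k x using Avg_C[of k x] by linarith
    have "ennreal (c + C) = (\<integral>\<^sup>+x. ennreal (c + C) \<partial>\<mu>)" by (simp add: emeasure_space_1)
    also have "\<dots> \<le> (\<integral>\<^sup>+x. liminf (\<lambda>k. ennreal (Avg T (F k) f x + C)) \<partial>\<mu>)"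
    proof (intro nn_integral_mono Liminf_bounded)
      show "\<forall>\<^sub>F k in sequentially. ennreal (c + C) \<le> ennreal (Avg T (F k) f x + C)" for x
        using ev[of x] by eventually_elim (auto intro!: ennreal_leI)
    qed
    also have "\<dots> \<le> liminf (\<lambda>k. \<integral>\<^sup>+x. ennreal (Avg T (F k) f x + C) \<partial>\<mu>)"
      by (rule nn_integral_liminf) (use m in measurable)
    also have "(\<lambda>k. \<integral>\<^sup>+x. ennreal (Avg T (F k) f x + C) \<partial>\<mu>) = (\<lambda>k. ennreal ((\<integral>x. f x \<partial>\<mu>) + C))"
    proof
      fix k
      have "(\<integral>\<^sup>+x. ennreal (Avg T (F k) f x + C) \<partial>\<mu>) = ennreal (\<integral>x. Avg T (F k) f x + C \<partial>\<mu>)"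
        using i nonneg by (intro nn_integral_eq_integral) auto
      also have "(\<integral>x. Avg T (F k) f x + C \<partial>\<mu>) = (\<integral>x. f x \<partial>\<mu>) + C"
        using i by (simp add: integral_Avg[OF \<mu> f] prob_space)
      finally show "(\<integral>\<^sup>+x. ennreal (Avg T (F k) f x + C) \<partial>\<mu>) = ennreal ((\<integral>x. f x \<partial>\<mu>) + C)" .
    qed
    finally have "ennreal (c + C) \<le> ennreal ((\<integral>x. f x \<partial>\<mu>) + C)" by (simp add: Liminf_const)
    \<comment> \<open>Makes the right-hand side nonnegative before \<open>ennreal\<close>, which
      truncates negative reals to 0, is removed.\<close>
    moreover have "\<bar>\<integral>x. f x \<partial>\<mu>\<bar> \<le> C"
      by (rule borel_probs_integral_bound[OF invariant_borel_probs[OF \<mu>] borel_measurable_continuous_onI[OF f] C(2)])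
    ultimately show False using c(1) by (simp add: ennreal_le_iff)
  qed
qed

lemma liminf_inf_Avg_le_c_lower: "liminf (inf_Avg T F f) \<le> c_lower T F f"
  unfolding c_lower_def
  unfolding inf_Avg_def by (intro INF_greatest Liminf_mono always_eventually allI INF_lower UNIV_I)

text \<open>The inequalities close a cycle: \<open>a_lower\<close>, the lower limit of
  \<open>inf_Avg\<close>, \<open>c_lower\<close>, and back to \<open>a_lower\<close>.\<close>

lemma c_lower_eq_a_lower: "continuous_on UNIV f \<Longrightarrow> c_lower T F f = a_lower G T f"
  by (meson a_lower_le_liminf_inf_Avg c_lower_le_a_lower liminf_inf_Avg_le_c_lower order.antisym order.trans)

lemma d_lower_eq_a_lower: "continuous_on UNIV f \<Longrightarrow> d_lower T F f = a_lower G T f"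
  unfolding d_lower_def by (rule limI[OF inf_Avg_tendsto])

text \<open>Attainment makes the value a real number; ergodicity of the minimizer is what connects
  it to typical points.\<close>

lemma a_lower_attained:
  assumes f: "continuous_on UNIV f"
  obtains \<theta> where "\<theta> \<in> ergodic_measures G T" and "a_lower G T f = ereal (\<integral>x. f x \<partial>\<theta>)"
proof -
  obtain \<theta> where \<theta>: "\<theta> \<in> ergodic_measures G T"
    "\<And>\<mu>. \<mu> \<in> invariant_measures G T \<Longrightarrow> (\<integral>x. f x \<partial>\<theta>) \<le> (\<integral>x. f x \<partial>\<mu>)"
    using ergodic_minimizer[OF f invariant_measures_nonempty] by blast
  have "a_lower G T f = ereal (\<integral>x. f x \<partial>\<theta>)"
    unfolding a_lower_def
  proof (rule order.antisym)
    show "(INF \<nu>\<in>invariant_measures G T. ereal (\<integral>y. f y \<partial>\<nu>)) \<le> ereal (\<integral>x. f x \<partial>\<theta>)"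
      using \<theta>(1) by (intro INF_lower) (simp add: ergodic_measures_def)
  qed (auto intro!: INF_greatest \<theta>(2))
  with \<theta>(1) show thesis by (rule that)
qed

lemma c_lower_le_b_lower: "c_lower T F f \<le> b_lower T F f"
  unfolding b_lower_def
proof (rule INF_greatest)
  fix x assume "x \<in> Reg T F f"
  then have "(\<lambda>k. Avg T (F k) f x) \<longlonglongrightarrow> lim (\<lambda>k. Avg T (F k) f x)"
    by (simp add: Reg_def convergent_LIMSEQ_iff)
  then have "liminf (\<lambda>k. ereal (Avg T (F k) f x)) = ereal (lim (\<lambda>k. Avg T (F k) f x))"
    by (intro lim_imp_Liminf) auto
  then show "c_lower T F f \<le> ereal (lim (\<lambda>k. Avg T (F k) f x))"
    unfolding c_lower_def by (metis INF_lower UNIV_I)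
qed

lemma b_lower_le_a_lower:
  assumes f: "continuous_on UNIV f"
    and typical: "\<And>\<theta>. \<theta> \<in> ergodic_measures G T \<Longrightarrow> \<exists>x. typical_point T F f \<theta> x"
  shows "b_lower T F f \<le> a_lower G T f"
proof -
  obtain \<theta> where \<theta>: "\<theta> \<in> ergodic_measures G T" "a_lower G T f = ereal (\<integral>x. f x \<partial>\<theta>)"
    by (rule a_lower_attained[OF f])
  obtain x where "typical_point T F f \<theta> x" using typical[OF \<theta>(1)] by blast
  then have x: "(\<lambda>k. Avg T (F k) f x) \<longlonglongrightarrow> (\<integral>y. f y \<partial>\<theta>)" by (simp add: typical_point_def)
  then have "x \<in> Reg T F f" by (auto simp: Reg_def convergent_def)
  then have "b_lower T F f \<le> ereal (lim (\<lambda>k. Avg T (F k) f x))"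
    unfolding b_lower_def by (rule INF_lower)
  then show ?thesis using \<theta>(2) limI[OF x] by simp
qed

end

section \<open>Upper values by change of sign\<close>

lemma a_upper_eq_uminus: "a_upper G T f = - a_lower G T (\<lambda>x. - f x)"
  by (simp add: a_upper_def a_lower_def ereal_INF_uminus_eq flip: uminus_ereal.simps(1))

lemma sup_Avg_eq_uminus: "sup_Avg T F f k = - inf_Avg T F (\<lambda>x. - f x) k"
  by (simp add: sup_Avg_def inf_Avg_def Avg_uminus ereal_INF_uminus_eq flip: uminus_ereal.simps(1))

lemma c_upper_eq_uminus: "c_upper T F f = - c_lower T F (\<lambda>x. - f x)"
  by (simp add: c_upper_def c_lower_def Avg_uminus ereal_INF_uminus_eq ereal_Liminf_uminus flip: uminus_ereal.simps(1))

lemma Reg_uminus: "Reg T F (\<lambda>x. - f x) = Reg T F f"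
  by (simp add: Reg_def Avg_uminus flip: convergent_minus_iff)

lemma b_upper_eq_uminus: "b_upper T F f = - b_lower T F (\<lambda>x. - f x)"
proof -
  \<comment> \<open>Restricted to \<open>Reg\<close>, since the value of \<open>lim\<close> on a
    divergent sequence carries no information. An empty \<open>Reg\<close> needs no separate
    treatment: negation exchanges the two infinite values.\<close>
  have "lim (\<lambda>k. - Avg T (F k) f x) = - lim (\<lambda>k. Avg T (F k) f x)" if "x \<in> Reg T F f" for x
    using that by (intro limI tendsto_minus) (simp add: Reg_def convergent_LIMSEQ_iff)
  then show ?thesis
    by (simp add: b_upper_def b_lower_def Reg_uminus Avg_uminus ereal_INF_uminus_eq
        flip: uminus_ereal.simps(1) cong: INF_cong)
qed

lemma typical_point_uminus: "typical_point T F (\<lambda>x. - f x) \<theta> x \<longleftrightarrow> typical_point T F f \<theta> x"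
  using tendsto_minus_cancel_left[of "\<lambda>k. - Avg T (F k) f x" "\<integral>y. f y \<partial>\<theta>" sequentially]
  by (simp add: typical_point_def Avg_uminus)

theorem theorem3p3:
  fixes G :: "('g, 'm) monoid_scheme"
    and T :: "'g \<Rightarrow> 'x::t2_space \<Rightarrow> 'x"
    and F :: "nat \<Rightarrow> 'g set"
    and f :: "'x \<Rightarrow> real"
  assumes "compact (UNIV :: 'x set)"
    and "metrizable_space (euclidean :: 'x topology)"
    and "group G"
    and "amenable_group G"
    and "action_by_homeos G T"
    and "folner_sequence G F"
    and "continuous_on UNIV f"
  shows "(\<bar>a_upper G T f\<bar> \<noteq> \<infinity> \<and> \<bar>a_lower G T f\<bar> \<noteq> \<infinity> \<and>
          \<bar>c_upper T F f\<bar> \<noteq> \<infinity> \<and> \<bar>c_lower T F f\<bar> \<noteq> \<infinity> \<and>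
          convergent (sup_Avg T F f) \<and> \<bar>d_upper T F f\<bar> \<noteq> \<infinity> \<and>
          convergent (inf_Avg T F f) \<and> \<bar>d_lower T F f\<bar> \<noteq> \<infinity>) \<and>
         (b_upper T F f \<le> c_upper T F f \<and> c_upper T F f = a_upper G T f \<and>
          a_upper G T f = d_upper T F f) \<and>
         (b_lower T F f \<ge> c_lower T F f \<and> c_lower T F f = a_lower G T f \<and>
          a_lower G T f = d_lower T F f) \<and>
         ((\<forall>\<theta> \<in> ergodic_measures G T. \<exists>x. typical_point T F f \<theta> x) \<longrightarrow>
            (a_upper G T f = b_upper T F f \<and> b_upper T F f = c_upper T F f \<and>
             c_upper T F f = d_upper T F f) \<and>
            (a_lower G T f = b_lower T F f \<and> b_lower T F f = c_lower T F f \<and>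
             c_lower T F f = d_lower T F f))"
proof -
  interpret folner_action G T F by (intro folner_action.intro compact_metrizable_action.intro folner_action_axioms.intro assms)
  let ?g = "\<lambda>x. - f x"
  note f = \<open>continuous_on UNIV f\<close>
  have g: "continuous_on UNIV ?g" by (intro continuous_intros f)
  have fin: "\<bar>a_lower G T h\<bar> \<noteq> \<infinity>" if "continuous_on UNIV h" for h :: "'x \<Rightarrow> real"
    by (rule a_lower_attained[OF that]) simp
  have sup: "sup_Avg T F f \<longlonglongrightarrow> a_upper G T f"
    using tendsto_uminus_ereal[OF inf_Avg_tendsto[OF g]]
    by (simp add: a_upper_eq_uminus sup_Avg_eq_uminus[abs_def])
  have a_up: "\<bar>a_upper G T f\<bar> \<noteq> \<infinity>" using fin[OF g] by (simp add: a_upper_eq_uminus)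
  have c_up: "c_upper T F f = a_upper G T f"
    by (simp add: c_upper_eq_uminus a_upper_eq_uminus c_lower_eq_a_lower[OF g])
  have d_up: "d_upper T F f = a_upper G T f" unfolding d_upper_def by (rule limI[OF sup])
  have b_up: "b_upper T F f \<le> c_upper T F f"
    by (simp add: b_upper_eq_uminus c_upper_eq_uminus c_lower_le_b_lower)
  \<comment> \<open>The same points are typical for \<open>f\<close> and for its negative, so the
    hypothesis applies both to an ergodic minimizer and to an ergodic maximizer of the integral of
    \<open>f\<close>.\<close>
  have typical: "b_lower T F f \<le> a_lower G T f \<and> a_upper G T f \<le> b_upper T F f"
    if "\<forall>\<theta> \<in> ergodic_measures G T. \<exists>x. typical_point T F f \<theta> x"
    using b_lower_le_a_lower[OF f] b_lower_le_a_lower[OF g] that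
    by (simp add: a_upper_eq_uminus b_upper_eq_uminus typical_point_uminus)
  show ?thesis
    using fin[OF f] a_up c_up d_up b_up sup inf_Avg_tendsto[OF f] c_lower_eq_a_lower[OF f]
      d_lower_eq_a_lower[OF f] c_lower_le_b_lower[of f] typical
    by (auto simp: convergent_def intro: order.antisym)
qed

end
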